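(* Let the sequence $\{(z_n,x_n,w_n,y_n,\tau_n)\}$ be generated by the P-GRPDA iteration described in the context, where the parameters $\psi,\mu,\mu'$ satisfy \begin{equation*} 0<3\mu'<\mu<\frac{\psi}{2}+\frac{\psi(1+\psi-\psi^2)}{2(\psi+1)},\qquad \psi\in(1,1+\sqrt{3}). \end{equation*} Then $\{(x_n,y_n)\}$ converges to a solution of the saddle point problem $\min_{x\in\mathbb{X}}\max_{y\in\mathbb{Y}} \mathbb{L}(x,y)=f(x)+h(x)+\langle Kx,y\rangle-g^*(y)$.
   Context: Let $\mathbb{X},\mathbb{Y}$ be finite-dimensional real Hilbert spaces, $K:\mathbb{X}\to\mathbb{Y}$ a linear operator with adjoint $K^*$, $f:\mathbb{X}\to(-\infty,\infty]$ and $g:\mathbb{Y}\to(-\infty,\infty]$ proper, convex, lower semicontinuous, with $g^*$ the Legendre–Fenchel conjugate of $g$, and $h:\mathbb{X}\to\mathbb{R}$ convex and differentiable with $\bar L$-Lipschitz continuous gradient. Assume the set of solutions of the saddle point problem $\min_x\max_y f(x)+h(x)+\langle Kx,y\rangle-g^*(y)$ is nonempty, that $0\in\operatorname{ri}\big(K(\operatorname{dom} f)-\operatorname{dom} g\big)$, and that the proximal operators of $f$ and $g$ can be evaluated efficiently. The P-GRPDA iteration: choose $x_0\in\mathbb{X}$, $y_0\in\mathbb{Y}$, $z_0=x_0$, $\beta>0$, $\tau_0>0$, and for $n\ge1$ compute $z_n=\frac{\psi-1}{\psi}x_{n-1}+\frac1\psi z_{n-1}$, $x_n=\operatorname{prox}_{\tau_{n-1}f}\big(z_n-\tau_{n-1}K^*y_{n-1}-\tau_{n-1}\nabla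 h(x_{n-1})\big)$, $\tau_n=\min\Big\{\tau_{n-1},\ \frac{\mu\|x_n-x_{n-1}\|}{\sqrt\beta\,\|Kx_n-Kx_{n-1}\|},\ \frac{\mu'\|x_n-x_{n-1}\|}{\|\nabla h(x_n)-\nabla h(x_{n-1})\|}\Big\}$ (with conventions $1/0=\infty$ and $0/0=\infty$), $\sigma_n=\beta\tau_n$, $w_n=\operatorname{prox}_{\frac{1}{\sigma_n}g}\big(\frac{y_{n-1}}{\sigma_n}+Kx_n\big)$, $y_n=y_{n-1}+\sigma_n(Kx_n-w_n)$ (equivalently $y_n=\operatorname{prox}_{\sigma_n g^*}(y_{n-1}+\sigma_nKx_n)$). *)

theory Defs
  imports "HOL-Analysis.Analysis"
begin

definition edom :: "('a \<Rightarrow> ereal) \<Rightarrow> 'a set" where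
  "edom f = {x. f x < \<infinity>}"

definition proper_fun :: "('a \<Rightarrow> ereal) \<Rightarrow> bool" where
  "proper_fun f \<longleftrightarrow> (\<forall>x. f x \<noteq> -\<infinity>) \<and> (\<exists>x. f x \<noteq> \<infinity>)"

definition convex_fun :: "('a::real_vector \<Rightarrow> ereal) \<Rightarrow> bool" where
  "convex_fun f \<longleftrightarrow> (\<forall>x y t. 0 \<le> t \<and> t \<le> 1 \<longrightarrow>
      f ((1 - t) *\<^sub>R x + t *\<^sub>R y) \<le> ereal (1 - t) * f x + ereal t * f y)"

definition lsc_fun :: "('a::topological_space \<Rightarrow> ereal) \<Rightarrow> bool" where
  "lsc_fun f \<longleftrightarrow> (\<forall>c. closed {x. f x \<le> c})"

definition conj_fun :: "('a::real_inner \<Rightarrow> ereal) \<Rightarrow> 'a \<Rightarrow> ereal" where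
  "conj_fun g y = (SUP x. ereal (inner x y) - g x)"

definition prox :: "real \<Rightarrow> ('a::real_normed_vector \<Rightarrow> ereal) \<Rightarrow> 'a \<Rightarrow> 'a" where
  "prox t f v = (THE u. \<forall>w. ereal t * f u + ereal ((norm (u - v))\<^sup>2 / 2)
                              \<le> ereal t * f w + ereal ((norm (w - v))\<^sup>2 / 2))"

definition lagr :: "('a \<Rightarrow> ereal) \<Rightarrow> ('a \<Rightarrow> real) \<Rightarrow> ('a \<Rightarrow> 'b::real_inner) \<Rightarrow> ('b \<Rightarrow> ereal)
                     \<Rightarrow> 'a \<Rightarrow> 'b \<Rightarrow> ereal" where
  "lagr f h K g x y = f x + ereal (h x) + ereal (inner (K x) y) - conj_fun g y"

text \<open>Saddle point (solution) of min_x max_y L(x,y).  The inequalities are only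
 evaluated where L is well defined (x* in dom f, y* in dom g*).\<close>
definition saddle_point :: "('a \<Rightarrow> ereal) \<Rightarrow> ('a \<Rightarrow> real) \<Rightarrow> ('a \<Rightarrow> 'b::real_inner) \<Rightarrow> ('b \<Rightarrow> ereal)
                     \<Rightarrow> 'a \<Rightarrow> 'b \<Rightarrow> bool" where
  "saddle_point f h K g xs ys \<longleftrightarrow> xs \<in> edom f \<and> ys \<in> edom (conj_fun g) \<and>
     (\<forall>x y. lagr f h K g xs y \<le> lagr f h K g xs ys \<and> lagr f h K g xs ys \<le> lagr f h K g x ys)"

end

theory Submission
  imports Defs
begin

text \<open>The optimality conditions of the proximal steps say that \<open>x\<^bsub>n\<^esub>\<close> and \<open>w\<^bsub>n\<^esub>\<close> carry explicit
 subgradients of \<open>f\<close> and \<open>g\<close>. Adding the subgradient inequality at \<open>x\<^bsub>n+1\<^esub>\<close> (tested at a saddle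
 point \<open>x\<^sup>*\<close>), the one at \<open>x\<^bsub>n\<^esub>\<close> (tested at \<open>x\<^bsub>n+1\<^esub>\<close>), the one at \<open>y\<^bsub>n\<^esub>\<close> for the conjugate of \<open>g\<close>, and
 the saddle point inequalities shows that
 \<open>\<psi>/(\<psi>-1) |z\<^bsub>n+2\<^esub> - x\<^sup>*|\<^sup>2 + |y\<^bsub>n\<^esub> - y\<^sup>*|\<^sup>2/\<beta> + \<mu>' |x\<^bsub>n+1\<^esub> - x\<^bsub>n\<^esub>|\<^sup>2\<close> eventually decreases by at least
 a fixed multiple of the squared increments of \<open>x\<close> and \<open>y\<close>, because the step sizes decrease to a
 positive limit and hence their consecutive ratios tend to 1. So the increments vanish, every
 cluster point is a saddle point since subdifferentials have closed graph, and the energy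
 relative to such a cluster point converges to 0.\<close>

section \<open>Subgradients and proximal points\<close>

text \<open>Membership of \<open>p\<close> in the convex subdifferential of \<open>f\<close> at
  \<open>u\<close>. The finiteness clause matters because at a point of value
  \<open>-\<infinity>\<close> the inequality alone would accept every \<open>p\<close>; it also lets
  later arguments pass to real numbers.\<close>

definition subgrad :: "('a::real_inner \<Rightarrow> ereal) \<Rightarrow> 'a \<Rightarrow> 'a \<Rightarrow> bool" where
  "subgrad f u p \<longleftrightarrow> \<bar>f u\<bar> \<noteq> \<infinity> \<and> (\<forall>v. f u + ereal (inner p (v - u)) \<le> f v)"

section \<open>Lower semicontinuity along sequences and lower bounds for convex functions\<close>

lemma lsc_fun_limit:
  fixes u :: "nat \<Rightarrow> 'a::metric_space"
  assumes "lsc_fun f" "u \<longlonglongrightarrow> l" "r \<longlonglongrightarrow> c" and le: "\<And>n. f (u n) \<le> ereal (r n)"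
  shows "f l \<le> ereal c"
proof (rule ereal_le_epsilon2)
  fix e :: real assume "0 < e"
  \<comment> \<open>The slack \<open>e\<close> puts a whole tail of \<open>u\<close> into one fixed
    closed sublevel set, although the bounds \<open>r n\<close> vary.\<close>
  have cl: "closed {x. f x \<le> ereal (c + e)}"
    using assms(1) by (simp add: lsc_fun_def)
  have "\<forall>\<^sub>F n in sequentially. r n < c + e"
    using assms(3) \<open>0 < e\<close> by (intro order_tendstoD) auto
  then have "\<forall>\<^sub>F n in sequentially. u n \<in> {x. f x \<le> ereal (c + e)}"
  proof eventually_elim
    case (elim n)
    then show ?case using le[of n] by (auto intro: order_trans)
  qed
  then have "l \<in> {x. f x \<le> ereal (c + e)}"
    using Lim_in_closed_set[OF cl _ sequentially_bot assms(2)] by blast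
  then show "f l \<le> ereal c + ereal e" by simp
qed

text \<open>Points with values below \<open>- k\<close> for every \<open>k\<close> would have a
  cluster point in the compact set, and lower semicontinuity would force the excluded value
  \<open>-\<infinity>\<close> there.\<close>

lemma lsc_fun_bounded_below_on_compact:
  fixes f :: "'a::metric_space \<Rightarrow> ereal"
  assumes "lsc_fun f" "compact S" "\<And>x. f x \<noteq> -\<infinity>"
  shows "\<exists>m::real. \<forall>x\<in>S. ereal m \<le> f x"
proof (rule ccontr)
  assume "\<not> ?thesis"
  then have "\<forall>k::nat. \<exists>x\<in>S. f x < ereal (- real k)" by (meson not_le)
  then obtain u where uS: "\<And>k. u k \<in> S" and u: "\<And>k. f (u k) < ereal (- real k)"
    by metis
  then obtain l r where "strict_mono r" and lim: "(u \<circ> r) \<longlonglongrightarrow> l"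
    using \<open>compact S\<close> unfolding compact_def by metis
  have "f l \<le> ereal (- real k)" for k
  proof -
    \<comment> \<open>Dropping the first \<open>k\<close> terms leaves indices
      \<open>r (n + k) \<ge> k\<close>, so the single bound \<open>- k\<close> holds along the whole
      shifted sequence.\<close>
    have "(\<lambda>n. u (r (n + k))) \<longlonglongrightarrow> l"
      using LIMSEQ_ignore_initial_segment[OF lim, of k] by (simp add: o_def)
    moreover have "f (u (r (n + k))) \<le> ereal (- real k)" for n
    proof -
      have "k \<le> r (n + k)" using seq_suble[OF \<open>strict_mono r\<close>, of "n + k"] by simp
      then have "ereal (- real (r (n + k))) \<le> ereal (- real k)" by simp
      then show ?thesis using u[of "r (n + k)"] by (meson less_imp_le order_trans)
    qed
    ultimately show ?thesis
      by (rule lsc_fun_limit[OF assms(1) _ tendsto_const])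
  qed
  then have "f l \<le> ereal B" for B
    using real_arch_simple[of "- B"] by (meson ereal_less_eq(3) minus_le_iff order_trans)
  then have "f l = -\<infinity>" by (rule ereal_bot)
  then show False using assms(3) by blast
qed

text \<open>Linear growth downwards is the worst that convexity allows: a lower bound on the unit
  ball around a point of the domain is carried outward along rays. This replaces an affine minorant
  in the existence proof for proximal points.\<close>

lemma convex_fun_linear_lower_bound:
  fixes f :: "'a::euclidean_space \<Rightarrow> ereal"
  assumes f: "proper_fun f" "convex_fun f" "lsc_fun f"
  shows "\<exists>A. \<forall>u. ereal (- A * (1 + norm u)) \<le> f u"
proof -
  obtain x0 where x0: "f x0 \<noteq> \<infinity>" using f by (auto simp: proper_fun_def)
  have ninf: "f x \<noteq> -\<infinity>" for x using f by (auto simp: proper_fun_def)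
  obtain a where a: "f x0 = ereal a" using x0 ninf[of x0] by (cases "f x0") auto
  obtain m where m: "\<And>x. x \<in> cball x0 1 \<Longrightarrow> ereal m \<le> f x"
    using lsc_fun_bounded_below_on_compact[OF f(3) compact_cball ninf] by blast
  \<comment> \<open>Serves both cases: \<open>- B \<le> m\<close> inside the ball, and
    \<open>\<bar>m\<bar> + \<bar>a\<bar>\<close> dominates the slope outside it.\<close>
  define B where "B = \<bar>m\<bar> + \<bar>a\<bar>"
  have bound: "ereal (- B * (1 + norm (u - x0))) \<le> f u" for u
  proof (cases "norm (u - x0) \<le> 1")
    case True
    then have "ereal m \<le> f u" by (intro m) (simp add: dist_norm norm_minus_commute)
    moreover have "- B * (1 + norm (u - x0)) \<le> m"
    proof -
      have "0 \<le> B * norm (u - x0)" "- B \<le> m" by (simp_all add: B_def)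
      then show ?thesis by (simp only: distrib_left mult_minus_left mult_1_right)
    qed
    ultimately show ?thesis by (meson ereal_less_eq(3) order_trans)
  next
    case False
    define r where "r = norm (u - x0)"
    have r: "r > 1" using False r_def by simp
    show ?thesis
    proof (cases "f u")
      case (real b)
      \<comment> \<open>This convex combination is the point of the segment from \<open>x0\<close>
        to \<open>u\<close> at distance 1 from \<open>x0\<close>, where the bound \<open>m\<close>
        is available.\<close>
      have p: "(1 - 1 / r) *\<^sub>R x0 + (1 / r) *\<^sub>R u = x0 + (1 / r) *\<^sub>R (u - x0)"
        by (simp add: algebra_simps)
      have "ereal m \<le> f ((1 - 1 / r) *\<^sub>R x0 + (1 / r) *\<^sub>R u)"
        unfolding p using r by (intro m) (simp add: dist_norm r_def)
      also have "\<dots> \<le> ereal (1 - 1 / r) * f x0 + ereal (1 / r) * f u"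
        using f(2) r unfolding convex_fun_def by auto
      finally have "m \<le> (1 - 1 / r) * a + (1 / r) * b" using a real by simp
      then have "r * m \<le> r * ((1 - 1 / r) * a + (1 / r) * b)" using r by simp
      also have "\<dots> = (r - 1) * a + b" using r by (simp add: field_simps)
      finally have "r * m - (r - 1) * a \<le> b" by simp
      moreover have "r * - \<bar>m\<bar> \<le> r * m" using r by (intro mult_left_mono) auto
      moreover have "(r - 1) * a \<le> (r - 1) * \<bar>a\<bar>" using r by (intro mult_left_mono) auto
      moreover have "0 \<le> \<bar>a\<bar>" "0 \<le> \<bar>m\<bar>" by auto
      ultimately have "- B * (1 + r) \<le> b" by (simp add: B_def algebra_simps)
      then show ?thesis using real r_def by simp
    qed (use ninf in auto)
  qed
  \<comment> \<open>Recentring from \<open>x0\<close> to the origin costs the factor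
    \<open>1 + norm x0\<close>.\<close>
  have "ereal (- (B * (1 + norm x0)) * (1 + norm u)) \<le> f u" for u
  proof -
    have "B \<ge> 0" by (simp add: B_def)
    have "norm (u - x0) \<le> norm u + norm x0" by (rule norm_triangle_ineq4)
    then have "1 + norm (u - x0) \<le> (1 + norm u) * (1 + norm x0)"
      using mult_nonneg_nonneg[OF norm_ge_zero[of u] norm_ge_zero[of x0]]
      by (simp only: distrib_left distrib_right mult_1 mult_1_right)
    then have "1 + norm (u - x0) \<le> (1 + norm x0) * (1 + norm u)" by (simp add: mult.commute)
    then have "B * (1 + norm (u - x0)) \<le> B * ((1 + norm x0) * (1 + norm u))"
      using \<open>B \<ge> 0\<close> by (rule mult_left_mono)
    then have "- (B * (1 + norm x0)) * (1 + norm u) \<le> - B * (1 + norm (u - x0))"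
      by (simp add: mult.assoc)
    then show ?thesis using bound[of u] by (meson ereal_less_eq(3) order_trans)
  qed
  then show ?thesis by blast
qed

section \<open>Existence of proximal points and their optimality condition\<close>

lemma quadratic_sublevel_bound:
  fixes s :: real
  assumes "s\<^sup>2 \<le> a + b * s" "0 \<le> s"
  shows "s \<le> 1 + \<bar>a\<bar> + \<bar>b\<bar>"
proof (rule ccontr)
  assume "\<not> ?thesis"
  then have *: "1 + \<bar>a\<bar> + \<bar>b\<bar> < s" by simp
  then have "(1 + \<bar>a\<bar> + \<bar>b\<bar>) * s \<le> s * s" using assms(2) by (intro mult_right_mono) auto
  moreover have "b * s \<le> \<bar>b\<bar> * s" using assms(2) by (intro mult_right_mono) auto
  moreover have "\<bar>a\<bar> * 1 \<le> \<bar>a\<bar> * s" using * by (intro mult_left_mono) auto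
  ultimately have "(1 + \<bar>a\<bar> + \<bar>b\<bar>) * s \<le> \<bar>a\<bar> * s + \<bar>b\<bar> * s"
    using assms(1) by (simp add: power2_eq_square)
  then show False using * by (simp add: algebra_simps)
qed

text \<open>Direct method: the quadratic term beats the linear lower bound of \<open>f\<close>, so a
  minimizing sequence is bounded, and lower semicontinuity makes a subsequential limit a
  minimizer.\<close>

lemma prox_minimizer_exists:
  fixes f :: "'a::euclidean_space \<Rightarrow> ereal"
  assumes f: "proper_fun f" "convex_fun f" "lsc_fun f" and t: "0 < t"
  shows "\<exists>u. \<forall>w. ereal t * f u + ereal ((norm (u - v))\<^sup>2 / 2)
                 \<le> ereal t * f w + ereal ((norm (w - v))\<^sup>2 / 2)"
proof -
  obtain A0 where A0: "\<And>u. ereal (- A0 * (1 + norm u)) \<le> f u"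
    using convex_fun_linear_lower_bound[OF f] by blast
  define A where "A = \<bar>A0\<bar> * (1 + norm v)"
  have A: "- A * (1 + norm (u - v)) \<le> a" if "f u \<le> ereal a" for u a
  proof -
    have "ereal (- A0 * (1 + norm u)) \<le> ereal a" using A0 that order_trans by blast
    then have "- A0 * (1 + norm u) \<le> a" by simp
    moreover have "A0 * (1 + norm u) \<le> \<bar>A0\<bar> * (1 + norm u)" by (intro mult_right_mono) auto
    moreover have "\<bar>A0\<bar> * (1 + norm u) \<le> \<bar>A0\<bar> * ((1 + norm v) * (1 + norm (u - v)))"
    proof (rule mult_left_mono)
      have "norm u \<le> norm v + norm (u - v)" by (rule norm_triangle_sub)
      then show "1 + norm u \<le> (1 + norm v) * (1 + norm (u - v))"
        using mult_nonneg_nonneg[OF norm_ge_zero[of v] norm_ge_zero[of "u - v"]]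
        by (simp only: distrib_left distrib_right mult_1 mult_1_right)
    qed simp
    ultimately show ?thesis by (simp add: A_def mult.assoc)
  qed
  have ninf: "f x \<noteq> -\<infinity>" for x using f by (auto simp: proper_fun_def)
  \<comment> \<open>Taking all real majorants \<open>a\<close> of \<open>f u\<close> gives a set of
    reals: points with \<open>f u = \<infinity>\<close> contribute nothing, and its infimum is the
    infimum of the proximal objective.\<close>
  define S where "S = {t * a + (norm (u - v))\<^sup>2 / 2 | u a. f u \<le> ereal a}"
  obtain x0 where "f x0 \<noteq> \<infinity>" using f by (auto simp: proper_fun_def)
  then obtain a0 where "f x0 \<le> ereal a0" using ninf[of x0] by (cases "f x0") auto
  then have Sne: "S \<noteq> {}" by (auto simp: S_def)
  have "- t * A - (t * A)\<^sup>2 / 2 \<le> s" if s: "s \<in> S" for s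
  proof -
    obtain u a where ua: "s = t * a + (norm (u - v))\<^sup>2 / 2" "f u \<le> ereal a"
      using s unfolding S_def by blast
    have "t * (- A * (1 + norm (u - v))) \<le> t * a" using A[OF ua(2)] t by (intro mult_left_mono) auto
    \<comment> \<open>Completing the square in \<open>norm (u - v)\<close> yields the uniform lower
      bound on \<open>S\<close>.\<close>
    moreover have "0 \<le> (norm (u - v) - t * A)\<^sup>2" by simp
    ultimately show ?thesis unfolding ua by (simp add: power2_diff algebra_simps)
  qed
  then have bdd: "bdd_below S" by (meson bdd_belowI)
  define m where "m = Inf S"
  have "\<exists>u a. f u \<le> ereal a \<and> t * a + (norm (u - v))\<^sup>2 / 2 < m + inverse (real (Suc k))" for k
  proof -
    have "Inf S < m + inverse (real (Suc k))" by (simp add: m_def)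
    then obtain s where "s \<in> S" "s < m + inverse (real (Suc k))"
      using cInf_less_iff[OF Sne bdd] by blast
    then show ?thesis by (auto simp: S_def)
  qed
  then obtain u a where ua: "\<And>k. f (u k) \<le> ereal (a k)"
    and lt: "\<And>k. t * a k + (norm (u k - v))\<^sup>2 / 2 < m + inverse (real (Suc k))"
    by metis
  have ubd: "norm (u k - v) \<le> 1 + \<bar>2 * (m + 1) + 2 * t * A\<bar> + \<bar>2 * t * A\<bar>" for k
  proof (rule quadratic_sublevel_bound)
    have "t * (- A * (1 + norm (u k - v))) \<le> t * a k" using A[OF ua] t by (intro mult_left_mono) auto
    moreover have "inverse (real (Suc k)) \<le> 1" by (simp add: inverse_le_1_iff)
    ultimately show "(norm (u k - v))\<^sup>2 \<le> 2 * (m + 1) + 2 * t * A + 2 * t * A * norm (u k - v)"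
      using lt[of k] by (simp add: algebra_simps)
  qed simp
  have "u k \<in> cball v (1 + \<bar>2 * (m + 1) + 2 * t * A\<bar> + \<bar>2 * t * A\<bar>)" for k
    using ubd[of k] by (simp add: dist_norm norm_minus_commute)
  then obtain l r where r: "strict_mono r" and lim: "(u \<circ> r) \<longlonglongrightarrow> l"
    using compact_cball unfolding compact_def by metis
  \<comment> \<open>The value that \<open>f l\<close> must not exceed for \<open>l\<close> to attain
    the infimum \<open>m\<close>.\<close>
  define c where "c = (m - (norm (l - v))\<^sup>2 / 2) / t"
  have inv0: "(\<lambda>n. inverse (real (Suc (r n)))) \<longlonglongrightarrow> 0"
    using LIMSEQ_subseq_LIMSEQ[OF LIMSEQ_inverse_real_of_nat r] by (simp add: o_def)
  have lim': "(\<lambda>n. u (r n)) \<longlonglongrightarrow> l" using lim by (simp add: o_def)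
  have "(\<lambda>n. (m + inverse (real (Suc (r n))) - (norm (u (r n) - v))\<^sup>2 / 2) / t)
          \<longlonglongrightarrow> (m + 0 - (norm (l - v))\<^sup>2 / 2) / t"
    using t by (intro tendsto_intros inv0 lim') auto
  moreover have "f (u (r n)) \<le> ereal ((m + inverse (real (Suc (r n))) - (norm (u (r n) - v))\<^sup>2 / 2) / t)"
    for n
  proof -
    have "a (r n) \<le> (m + inverse (real (Suc (r n))) - (norm (u (r n) - v))\<^sup>2 / 2) / t"
      using lt[of "r n"] t by (simp add: pos_le_divide_eq mult.commute)
    then show ?thesis using ua[of "r n"] by (meson ereal_less_eq(3) order_trans)
  qed
  ultimately have fl: "f l \<le> ereal c"
    using lsc_fun_limit[OF f(3) lim'] by (simp add: c_def)
  then obtain b where b: "f l = ereal b" "b \<le> c" using ninf[of l] by (cases "f l") auto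
  have "t * b \<le> t * c" using b t by simp
  then have low: "t * b + (norm (l - v))\<^sup>2 / 2 \<le> m" using t by (simp add: c_def)
  have "ereal t * f l + ereal ((norm (l - v))\<^sup>2 / 2) \<le> ereal t * f w + ereal ((norm (w - v))\<^sup>2 / 2)" for w
  proof (cases "f w")
    case (real d)
    have "t * d + (norm (w - v))\<^sup>2 / 2 \<in> S"
      unfolding S_def mem_Collect_eq using real by (intro exI[of _ w] exI[of _ d]) simp
    then have "m \<le> t * d + (norm (w - v))\<^sup>2 / 2" using bdd by (simp add: m_def cInf_lower)
    then show ?thesis using low b real by simp
  qed (use ninf t in auto)
  then show ?thesis by blast
qed

text \<open>First-order optimality: compare \<open>u\<close> with
  \<open>(1 - s) *\<^sub>R u + s *\<^sub>R w\<close>, use convexity of \<open>f\<close>, divide by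
  \<open>s\<close>, and let \<open>s\<close> tend to 0 from the right.\<close>

lemma prox_minimizer_subgrad:
  fixes f :: "'a::euclidean_space \<Rightarrow> ereal"
  assumes f: "proper_fun f" "convex_fun f" and t: "0 < t"
    and min: "\<And>w. ereal t * f u + ereal ((norm (u - v))\<^sup>2 / 2)
                 \<le> ereal t * f w + ereal ((norm (w - v))\<^sup>2 / 2)"
  shows "subgrad f u ((1 / t) *\<^sub>R (v - u))"
  unfolding subgrad_def
proof (intro conjI allI)
  have ninf: "f x \<noteq> -\<infinity>" for x using f by (auto simp: proper_fun_def)
  obtain x0 where "f x0 \<noteq> \<infinity>" using f by (auto simp: proper_fun_def)
  then obtain a0 where "f x0 = ereal a0" using ninf[of x0] by (cases "f x0") auto
  then have "f u \<noteq> \<infinity>" using min[of x0] t by (cases "f u") auto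
  then obtain a where a: "f u = ereal a" using ninf[of u] by (cases "f u") auto
  then show "\<bar>f u\<bar> \<noteq> \<infinity>" by simp
  fix w
  show "f u + ereal (inner ((1 / t) *\<^sub>R (v - u)) (w - u)) \<le> f w"
  proof (cases "f w")
    case (real b)
    have ineq: "0 \<le> t * (b - a) + inner (u - v) (w - u) + s * ((norm (w - u))\<^sup>2 / 2)"
      if s: "0 < s" "s \<le> 1" for s
    proof -
      let ?p = "(1 - s) *\<^sub>R u + s *\<^sub>R w"
      have "f ?p \<le> ereal (1 - s) * f u + ereal s * f w"
        using f(2) s unfolding convex_fun_def by auto
      then have fp: "f ?p \<le> ereal ((1 - s) * a + s * b)" using a real by simp
      then obtain c where c: "f ?p = ereal c" using ninf[of ?p] by (cases "f ?p") auto
      have "t * a + (norm (u - v))\<^sup>2 / 2 \<le> t * c + (norm (?p - v))\<^sup>2 / 2"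
        using min[of ?p] unfolding a c by simp
      moreover have "t * c \<le> t * ((1 - s) * a + s * b)" using fp c t by simp
      moreover have "?p - v = (u - v) + s *\<^sub>R (w - u)" by (simp add: algebra_simps)
      then have "(norm (?p - v))\<^sup>2 = (norm (u - v))\<^sup>2 + 2 * s * inner (u - v) (w - u) + s\<^sup>2 * (norm (w - u))\<^sup>2"
        by (simp only: power2_norm_eq_inner) (simp add: inner_simps inner_commute power2_eq_square algebra_simps)
      ultimately have "0 \<le> s * (t * (b - a) + inner (u - v) (w - u) + s * ((norm (w - u))\<^sup>2 / 2))"
        by (simp add: algebra_simps power2_eq_square)
      then show ?thesis using s by (simp add: zero_le_mult_iff)
    qed
    have "((\<lambda>s. t * (b - a) + inner (u - v) (w - u) + s * ((norm (w - u))\<^sup>2 / 2)) \<longlongrightarrow>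
            t * (b - a) + inner (u - v) (w - u) + 0 * ((norm (w - u))\<^sup>2 / 2)) (at_right 0)"
      by (intro tendsto_intros)
    moreover have "\<forall>\<^sub>F s in at_right 0. 0 \<le> t * (b - a) + inner (u - v) (w - u) + s * ((norm (w - u))\<^sup>2 / 2)"
      unfolding eventually_at_right_field using ineq by (intro exI[of _ 1]) auto
    ultimately have "0 \<le> t * (b - a) + inner (u - v) (w - u)"
      using tendsto_lowerbound[OF _ _ trivial_limit_at_right_real] by fastforce
    moreover have "inner (u - v) (w - u) = - inner (v - u) (w - u)" by (simp add: inner_diff_left)
    ultimately have "inner (v - u) (w - u) / t \<le> b - a" using t by (simp add: field_simps)
    then show ?thesis using a real by simp
  qed (use ninf in auto)
qed

text \<open>Since \<open>prox\<close> is a definite description, uniqueness is needed as well as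
  existence. Two minimizers carry subgradients, and adding the two subgradient inequalities, each
  tested at the other point, forces their distance to be 0.\<close>

lemma prox_subgrad:
  fixes f :: "'a::euclidean_space \<Rightarrow> ereal"
  assumes f: "proper_fun f" "convex_fun f" "lsc_fun f" and t: "0 < t"
  shows "subgrad f (prox t f v) ((1 / t) *\<^sub>R (v - prox t f v))"
proof -
  let ?M = "\<lambda>u. \<forall>w. ereal t * f u + ereal ((norm (u - v))\<^sup>2 / 2)
                              \<le> ereal t * f w + ereal ((norm (w - v))\<^sup>2 / 2)"
  have uniq: "u1 = u2" if m: "?M u1" "?M u2" for u1 u2
  proof -
    have s: "subgrad f u1 ((1 / t) *\<^sub>R (v - u1))" "subgrad f u2 ((1 / t) *\<^sub>R (v - u2))"
      using prox_minimizer_subgrad[OF f(1,2) t] m by blast+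
    obtain a1 a2 where a: "f u1 = ereal a1" "f u2 = ereal a2"
      using s unfolding subgrad_def by (cases "f u1"; cases "f u2") auto
    have "f u1 + ereal (inner ((1 / t) *\<^sub>R (v - u1)) (u2 - u1)) \<le> f u2"
      "f u2 + ereal (inner ((1 / t) *\<^sub>R (v - u2)) (u1 - u2)) \<le> f u1"
      using s unfolding subgrad_def by blast+
    then have "inner (v - u1) (u2 - u1) / t + inner (v - u2) (u1 - u2) / t \<le> 0"
      unfolding a by simp
    moreover have "inner (v - u1) (u2 - u1) + inner (v - u2) (u1 - u2) = (norm (u1 - u2))\<^sup>2"
      by (simp add: power2_norm_eq_inner inner_simps inner_commute)
    ultimately have "(norm (u1 - u2))\<^sup>2 / t \<le> 0" by (simp add: add_divide_distrib[symmetric])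
    then show ?thesis using t by (simp add: divide_le_0_iff)
  qed
  obtain u where u: "?M u" using prox_minimizer_exists[OF f t, of v] by blast
  have "?M (prox t f v)"
    unfolding prox_def by (rule theI[where P = ?M, OF u]) (use uniq u in blast)
  then show ?thesis by (intro prox_minimizer_subgrad f t) blast
qed

text \<open>Closed graph of the subdifferential. For a fixed test point the subgradient inequality
  is an upper bound on \<open>f (u n)\<close> with convergent right-hand side, so lower
  semicontinuity passes it to the limit.\<close>

lemma subgrad_limit:
  fixes u p :: "nat \<Rightarrow> 'a::euclidean_space"
  assumes f: "proper_fun f" "lsc_fun f" and sub: "\<And>n. subgrad f (u n) (p n)"
    and u: "u \<longlonglongrightarrow> l" and p: "p \<longlonglongrightarrow> q"
  shows "subgrad f l q"
proof -
  have ninf: "f x \<noteq> -\<infinity>" for x using f by (auto simp: proper_fun_def)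
  have le: "f l \<le> ereal (b - inner q (v - l))" if "f v = ereal b" for v b
  proof (rule lsc_fun_limit[OF f(2) u])
    show "(\<lambda>n. b - inner (p n) (v - u n)) \<longlonglongrightarrow> b - inner q (v - l)"
      by (intro tendsto_intros u p)
    fix n
    have "f (u n) + ereal (inner (p n) (v - u n)) \<le> ereal b"
      using sub[of n] that unfolding subgrad_def by metis
    then show "f (u n) \<le> ereal (b - inner (p n) (v - u n))" by (cases "f (u n)") auto
  qed
  \<comment> \<open>Testing at one point of finite value shows that \<open>f l\<close> is
    finite.\<close>
  obtain x0 where "f x0 \<noteq> \<infinity>" using f by (auto simp: proper_fun_def)
  then obtain a0 where "f x0 = ereal a0" using ninf[of x0] by (cases "f x0") auto
  then obtain a where a: "f l = ereal a" using le[of x0 a0] ninf[of l] by (cases "f l") auto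
  have "f l + ereal (inner q (v - l)) \<le> f v" for v
    using le[of v] a ninf[of v] by (cases "f v") auto
  then show ?thesis using a by (simp add: subgrad_def)
qed

section \<open>Conjugates, saddle points and the gradient inequality\<close>

lemma subgrad_conj_fun:
  assumes "subgrad g v p"
  shows "subgrad (conj_fun g) p v"
proof -
  obtain a where a: "g v = ereal a"
    using assms unfolding subgrad_def by (cases "g v") auto
  have ge: "ereal (inner v q - a) \<le> conj_fun g q" for q
    unfolding conj_fun_def by (rule SUP_upper2[of v]) (simp_all add: a)
  \<comment> \<open>The subgradient inequality says that \<open>v\<close> attains the supremum
    defining the conjugate at \<open>p\<close>: equality in Fenchel-Young there, against the mere
    inequality \<open>ge\<close> at every other \<open>q\<close>.\<close>
  have "conj_fun g p \<le> ereal (inner v p - a)"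
    unfolding conj_fun_def
  proof (rule SUP_least)
    fix u
    have "ereal a + ereal (inner p (u - v)) \<le> g u" using assms a unfolding subgrad_def by metis
    then show "ereal (inner u p) - g u \<le> ereal (inner v p - a)"
      by (cases "g u") (auto simp: inner_diff_right inner_commute)
  qed
  then have eq: "conj_fun g p = ereal (inner v p - a)" using ge antisym by blast
  show ?thesis
    unfolding subgrad_def
  proof (intro conjI allI)
    fix q
    show "conj_fun g p + ereal (inner v (q - p)) \<le> conj_fun g q"
      using ge[of q] by (simp add: eq inner_diff_right algebra_simps)
  qed (simp add: eq)
qed

lemma conj_fun_neq_MInfty:
  assumes "proper_fun g"
  shows "conj_fun g q \<noteq> -\<infinity>"
proof -
  obtain v where "g v \<noteq> \<infinity>" "g v \<noteq> -\<infinity>" using assms by (auto simp: proper_fun_def)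
  then obtain a where "g v = ereal a" by (cases "g v") auto
  then have "ereal (inner v q - a) \<le> conj_fun g q"
    unfolding conj_fun_def by (intro SUP_upper2[of v]) simp_all
  then show ?thesis by auto
qed

text \<open>With finite values at the saddle point, the two Lagrangian inequalities decouple: in
  \<open>y\<close> only the conjugate and a linear term remain, in \<open>x\<close> only a
  minimization. All differences of infinities disappear from this form.\<close>

lemma saddle_point_iff:
  assumes f: "proper_fun f" and g: "proper_fun g"
  shows "saddle_point f h K g xs ys \<longleftrightarrow>
    \<bar>f xs\<bar> \<noteq> \<infinity> \<and> subgrad (conj_fun g) ys (K xs) \<and>
    (\<forall>u. f xs + ereal (h xs + inner (K xs) ys) \<le> f u + ereal (h u + inner (K u) ys))"
    (is "?L \<longleftrightarrow> ?R")
proof (cases "\<bar>f xs\<bar> \<noteq> \<infinity> \<and> \<bar>conj_fun g ys\<bar> \<noteq> \<infinity>")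
  case True
  then obtain a b where a: "f xs = ereal a" and b: "conj_fun g ys = ereal b"
    by (cases "f xs"; cases "conj_fun g ys") auto
  have "lagr f h K g xs q \<le> lagr f h K g xs ys \<longleftrightarrow>
        conj_fun g ys + ereal (inner (K xs) (q - ys)) \<le> conj_fun g q" for q
    using conj_fun_neq_MInfty[OF g, of q] unfolding lagr_def a b
    by (cases "conj_fun g q") (auto simp: inner_diff_right)
  moreover have "lagr f h K g xs ys \<le> lagr f h K g u ys \<longleftrightarrow>
        f xs + ereal (h xs + inner (K xs) ys) \<le> f u + ereal (h u + inner (K u) ys)" for u
    unfolding lagr_def a b by (cases "f u") auto
  ultimately show ?thesis
    unfolding saddle_point_def subgrad_def using a b by (auto simp: edom_def)
next
  case False
  \<comment> \<open>Neither value can be \<open>-\<infinity>\<close>, so one of them is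
    \<open>\<infinity>\<close> and both sides of the equivalence fail.\<close>
  moreover have "f xs \<noteq> -\<infinity>" using f by (auto simp: proper_fun_def)
  ultimately show ?thesis using conj_fun_neq_MInfty[OF g, of ys]
    unfolding saddle_point_def subgrad_def edom_def by auto
qed

text \<open>Restricting \<open>h\<close> to the line through \<open>u\<close> and \<open>v\<close>
  reduces this to the tangent inequality for a convex function of one real variable.\<close>

lemma convex_on_gradient_ineq:
  fixes h :: "'a::real_inner \<Rightarrow> real"
  assumes "convex_on UNIV h" and der: "(h has_derivative (\<lambda>d. inner p d)) (at u)"
  shows "h u + inner p (v - u) \<le> h v"
proof -
  define \<phi> where "\<phi> = (\<lambda>s. h (u + s *\<^sub>R (v - u)))"
  have "convex_on UNIV \<phi>"
  proof (rule convex_onI)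
    fix t x y :: real assume t: "0 < t" "t < 1"
    have "u + ((1 - t) *\<^sub>R x + t *\<^sub>R y) *\<^sub>R (v - u)
        = (1 - t) *\<^sub>R (u + x *\<^sub>R (v - u)) + t *\<^sub>R (u + y *\<^sub>R (v - u))"
      by (simp add: algebra_simps)
    then show "\<phi> ((1 - t) *\<^sub>R x + t *\<^sub>R y) \<le> (1 - t) * \<phi> x + t * \<phi> y"
      unfolding \<phi>_def using convex_onD[OF assms(1), of t] t by simp
  qed simp
  moreover have "(\<phi> has_real_derivative inner p (v - u)) (at 0)"
  proof -
    have "(\<phi> has_derivative (\<lambda>d. inner p (d *\<^sub>R (v - u)))) (at 0)"
      unfolding \<phi>_def
      by (rule has_derivative_compose[where g = h and f = "\<lambda>s. u + s *\<^sub>R (v - u)"])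
        (auto intro!: derivative_eq_intros der)
    then show ?thesis by (simp add: has_field_derivative_def mult_commute_abs mult.commute)
  qed
  ultimately have "inner p (v - u) * (1 - 0) \<le> \<phi> 1 - \<phi> 0"
    by (intro convex_on_imp_above_tangent[where A = UNIV]) auto
  then show ?thesis by (simp add: \<phi>_def)
qed

section \<open>Energy estimates\<close>

lemma mult_le_half_sum_squares: "a * b \<le> (a\<^sup>2 + b\<^sup>2) / 2" for a b :: real
proof -
  have "2 * (a * b) \<le> a\<^sup>2 + b\<^sup>2" using sum_squares_bound[of a b] by (simp only: mult.assoc)
  then show ?thesis by simp
qed

text \<open>The left side is the exact minimum over \<open>p\<close>, attained at
  \<open>(e / (c + e)) *\<^sub>R d\<close>; the gap is a complete square. Only the sum of the
  weights has to be positive, either weight may be negative.\<close>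

lemma weighted_norm_lower_bound:
  fixes p d :: "'a::real_inner"
  assumes "0 < c + e"
  shows "c * e / (c + e) * (norm d)\<^sup>2 \<le> c * (norm p)\<^sup>2 + e * (norm (p - d))\<^sup>2"
proof -
  have "(c + e) * (c * (norm p)\<^sup>2 + e * (norm (p - d))\<^sup>2) - c * e * (norm d)\<^sup>2
      = (norm ((c + e) *\<^sub>R p - e *\<^sub>R d))\<^sup>2"
    by (simp only: power2_norm_eq_inner) (simp add: inner_simps inner_commute algebra_simps)
  then have "c * e * (norm d)\<^sup>2 \<le> (c + e) * (c * (norm p)\<^sup>2 + e * (norm (p - d))\<^sup>2)"
    by (metis diff_ge_0_iff_ge zero_le_power2)
  then show ?thesis using assms by (simp add: pos_divide_le_eq mult.commute)
qed

text \<open>With \<open>p = x\<^bsub>n+1\<^esub> - z\<^bsub>n+1\<^esub>\<close>, \<open>d = x\<^bsub>n+1\<^esub> - x\<^bsub>n\<^esub>\<close> and \<open>\<theta> = \<tau>\<^bsub>n\<^esub> / \<tau>\<^bsub>n-1\<^esub>\<close>, the primal part of the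
 descent is \<open>(1 + 1/\<psi> - \<theta>\<psi>) |p|\<^sup>2 + \<theta>\<psi> |p - d|\<^sup>2 + \<theta>\<psi> |d|\<^sup>2\<close>. Its minimum over \<open>p\<close> is
 the coefficient below times \<open>|d|\<^sup>2\<close>; the first weight may be negative, but the sum of
 the first two weights is always \<open>1 + 1/\<psi>\<close>. At \<open>\<theta> = 1\<close> the coefficient is twice the upper
 bound imposed on \<open>\<mu>\<close>.\<close>

definition descent_coeff :: "real \<Rightarrow> real \<Rightarrow> real" where
  "descent_coeff \<psi> \<theta> = \<theta> * \<psi> + (1 + 1 / \<psi> - \<theta> * \<psi>) * (\<theta> * \<psi>) / (1 + 1 / \<psi>)"

text \<open>Polarization turns the inner products of \<open>core\<close> into squared norms, the
  averaging rule for \<open>Z2\<close> trades the distance of \<open>X2\<close> to \<open>xs\<close>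
  for that of \<open>Z2\<close>, and the terms in \<open>X2 - Z1\<close> and \<open>X1 - Z1\<close>
  are minimized out. \<open>R\<close> stands for the coupling and gradient errors.\<close>

lemma golden_ratio_energy_step:
  fixes X1 X2 Z1 Z2 xs :: "'a::real_inner" and Y0 Y1 ys :: "'b::real_inner"
  assumes \<psi>: "1 < \<psi>" and Z2: "Z2 = ((\<psi> - 1) / \<psi>) *\<^sub>R X2 + (1 / \<psi>) *\<^sub>R Z1"
    and core: "inner (Z1 - X2) (xs - X2) + \<theta> * \<psi> * inner (Z1 - X1) (X2 - X1)
                 - 1 / \<beta> * inner (Y1 - Y0) (ys - Y1) \<le> R"
  shows "\<psi> / (\<psi> - 1) * (norm (Z2 - xs))\<^sup>2 + 1 / \<beta> * (norm (Y1 - ys))\<^sup>2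
       + descent_coeff \<psi> \<theta> * (norm (X2 - X1))\<^sup>2 + 1 / \<beta> * (norm (Y1 - Y0))\<^sup>2
       \<le> \<psi> / (\<psi> - 1) * (norm (Z1 - xs))\<^sup>2 + 1 / \<beta> * (norm (Y0 - ys))\<^sup>2 + 2 * R"
proof -
  let ?e = "\<theta> * \<psi>"
  let ?c = "1 + 1 / \<psi> - ?e"
  have i1: "2 * inner (Z1 - X2) (xs - X2) = (norm (X2 - Z1))\<^sup>2 + (norm (X2 - xs))\<^sup>2 - (norm (Z1 - xs))\<^sup>2"
    by (simp add: power2_norm_eq_inner inner_simps inner_commute algebra_simps)
  have i2: "2 * inner (Z1 - X1) (X2 - X1) = (norm (X1 - Z1))\<^sup>2 + (norm (X2 - X1))\<^sup>2 - (norm (X2 - Z1))\<^sup>2"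
    by (simp add: power2_norm_eq_inner inner_simps inner_commute algebra_simps)
  have i3: "2 * inner (Y1 - Y0) (ys - Y1) = (norm (Y0 - ys))\<^sup>2 - (norm (Y1 - Y0))\<^sup>2 - (norm (Y1 - ys))\<^sup>2"
    by (simp add: power2_norm_eq_inner inner_simps inner_commute algebra_simps)
  \<comment> \<open>The squared-norm identity for a convex combination, scaled by
    \<open>\<psi> / (\<psi> - 1)\<close> so that the distance of \<open>X2\<close> to
    \<open>xs\<close> has coefficient 1.\<close>
  have z: "\<psi> / (\<psi> - 1) * (norm (Z2 - xs))\<^sup>2
      = (norm (X2 - xs))\<^sup>2 + 1 / (\<psi> - 1) * (norm (Z1 - xs))\<^sup>2 - 1 / \<psi> * (norm (X2 - Z1))\<^sup>2"
  proof -
    have "Z2 - xs = (1 / \<psi>) *\<^sub>R ((\<psi> - 1) *\<^sub>R (X2 - xs) + (Z1 - xs))"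
      using \<psi> by (simp add: Z2 algebra_simps divide_simps scaleR_left_distrib[symmetric])
    then have "(norm (Z2 - xs))\<^sup>2 = (norm ((\<psi> - 1) *\<^sub>R (X2 - xs) + (Z1 - xs)))\<^sup>2 / \<psi>\<^sup>2"
      using \<psi> by (simp add: power_divide)
    also have "(norm ((\<psi> - 1) *\<^sub>R (X2 - xs) + (Z1 - xs)))\<^sup>2
        = (\<psi> - 1)\<^sup>2 * (norm (X2 - xs))\<^sup>2 + (norm (Z1 - xs))\<^sup>2 + 2 * (\<psi> - 1) * inner (X2 - xs) (Z1 - xs)"
      by (simp only: power2_norm_eq_inner) (simp add: inner_commute inner_left_distrib inner_right_distrib power2_eq_square)
    also have "2 * (\<psi> - 1) * inner (X2 - xs) (Z1 - xs)
        = (\<psi> - 1) * ((norm (X2 - xs))\<^sup>2 + (norm (Z1 - xs))\<^sup>2 - (norm (X2 - Z1))\<^sup>2)"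
      by (simp add: power2_norm_eq_inner inner_simps inner_commute algebra_simps)
    finally show ?thesis
      using \<psi> by (simp add: divide_simps) (simp add: power2_eq_square algebra_simps)
  qed
  have m: "?c * ?e / (1 + 1 / \<psi>) * (norm (X2 - X1))\<^sup>2 \<le> ?c * (norm (X2 - Z1))\<^sup>2 + ?e * (norm (X1 - Z1))\<^sup>2"
  proof -
    \<comment> \<open>The weights sum to \<open>1 + 1 / \<psi>\<close>, and \<open>X1 - Z1\<close>
      is \<open>(X2 - Z1) - (X2 - X1)\<close>, the shape required for the weighted bound.\<close>
    have "0 < ?c + ?e" using \<psi> by (simp add: add_pos_pos)
    from weighted_norm_lower_bound[OF this, of "X2 - X1" "X2 - Z1"] show ?thesis by simp
  qed
  have "2 * inner (Z1 - X2) (xs - X2) + ?e * (2 * inner (Z1 - X1) (X2 - X1))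
                 - 1 / \<beta> * (2 * inner (Y1 - Y0) (ys - Y1)) \<le> 2 * R"
    using core by simp
  then have s: "(norm (X2 - Z1))\<^sup>2 + (norm (X2 - xs))\<^sup>2 - (norm (Z1 - xs))\<^sup>2
     + ?e * ((norm (X1 - Z1))\<^sup>2 + (norm (X2 - X1))\<^sup>2 - (norm (X2 - Z1))\<^sup>2)
     - 1 / \<beta> * ((norm (Y0 - ys))\<^sup>2 - (norm (Y1 - Y0))\<^sup>2 - (norm (Y1 - ys))\<^sup>2) \<le> 2 * R"
    unfolding i1 i2 i3 .
  \<comment> \<open>The summand 1 pairs with the polarization term in \<open>Z1 - xs\<close>, the
    summand \<open>1 / (\<psi> - 1)\<close> with the one produced by \<open>z\<close>.\<close>
  have k: "\<psi> / (\<psi> - 1) = 1 + 1 / (\<psi> - 1)" using \<psi> by (simp add: field_simps)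
  have combine: "(b' + k * c' - p * a') + b * w' + (e + M) * d' + b * v' \<le> (1 + k) * c' + b * u' + S"
    if "a' + b' - c' + e * (q' + d' - a') - b * (u' - v' - w') \<le> S" "M * d' \<le> (1 + p - e) * a' + e * q'"
    for a' b' c' d' q' u' v' w' e b k p M S :: real
    using that by (simp add: algebra_simps)
  show ?thesis
    unfolding z unfolding k descent_coeff_def by (rule combine[OF s m])
qed

lemma descent_coeff_1:
  assumes "0 < \<psi>"
  shows "descent_coeff \<psi> 1 = 2 * (\<psi> / 2 + \<psi> * (1 + \<psi> - \<psi>\<^sup>2) / (2 * (\<psi> + 1)))"
proof -
  have eqs: "1 + 1 / \<psi> - 1 * \<psi> = (1 + \<psi> - \<psi>\<^sup>2) / \<psi>" "1 + 1 / \<psi> = (\<psi> + 1) / \<psi>"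
    using assms by (auto simp: field_simps power2_eq_square)
  show ?thesis unfolding descent_coeff_def eqs using assms
    by (simp add: divide_simps) (simp add: algebra_simps power2_eq_square)
qed

text \<open>Needed to force \<open>\<mu> < 1\<close>, so that the dual increments keep a positive
  weight. The claim amounts to \<open>2 * \<psi>\<^sup>2 - \<psi> ^ 3 < 2\<close>: below 2 it
  follows from \<open>\<psi> * (\<psi> - 1)\<^sup>2 \<ge> 0\<close>, from 2 on the left side is at
  most 0.\<close>

lemma descent_coeff_1_less_2:
  assumes "0 < \<psi>"
  shows "descent_coeff \<psi> 1 < 2"
proof -
  have "0 \<le> \<psi> * (\<psi> - 1)\<^sup>2" "0 \<le> (\<psi> - 1)\<^sup>2" using assms by simp_all
  moreover have "\<psi> ^ 3 - 2 * \<psi>\<^sup>2 + \<psi> = \<psi> * (\<psi> - 1)\<^sup>2"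
    by (simp add: power2_eq_square power3_eq_cube algebra_simps)
  ultimately have *: "2 * \<psi>\<^sup>2 - \<psi> ^ 3 \<le> \<psi>" by linarith
  have "2 * \<psi>\<^sup>2 - \<psi> ^ 3 < 2"
  proof (cases "\<psi> < 2")
    case True
    then show ?thesis using * by linarith
  next
    case False
    then have "\<psi>\<^sup>2 * (2 - \<psi>) \<le> 0" by (simp add: mult_nonneg_nonpos)
    moreover have "\<psi>\<^sup>2 * (2 - \<psi>) = 2 * \<psi>\<^sup>2 - \<psi> ^ 3"
      by (simp add: power2_eq_square power3_eq_cube algebra_simps)
    ultimately show ?thesis by linarith
  qed
  then have "\<psi> * (2 + 2 * \<psi> - \<psi>\<^sup>2) < 2 * (\<psi> + 1)"
    by (simp add: power2_eq_square power3_eq_cube algebra_simps)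
  moreover have "descent_coeff \<psi> 1 = \<psi> * (2 + 2 * \<psi> - \<psi>\<^sup>2) / (\<psi> + 1)"
    unfolding descent_coeff_1[OF assms] using assms by (simp add: field_simps)
  ultimately show ?thesis using assms by (simp add: pos_divide_less_eq)
qed

text \<open>Once the perturbation stays below a small \<epsilon>, the recursion contracts up to a
  fixed error: a geometric term plus \<open>\<delta> / 2\<close> bounds the sequence.\<close>

lemma perturbed_contraction_tendsto_0:
  fixes a b :: "nat \<Rightarrow> real"
  assumes q: "0 \<le> q" "q < 1" and a: "\<And>n. 0 \<le> a n" and step: "\<And>n. a (Suc n) \<le> q * (a n + b n)"
    and b: "b \<longlonglongrightarrow> 0"
  shows "a \<longlonglongrightarrow> 0"
proof (rule LIMSEQ_I)
  fix \<delta> :: real assume "0 < \<delta>"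
  \<comment> \<open>Chosen so that the error level \<open>\<delta> / 2\<close> reproduces itself:
    the recursion maps it to at most \<open>\<delta> / 2\<close>, with surplus
    \<open>\<delta> / 2 * (1 - q)\<^sup>2\<close>.\<close>
  define \<epsilon> where "\<epsilon> = (1 - q) * \<delta> / 2"
  have "\<epsilon> > 0" using \<open>0 < \<delta>\<close> q by (simp add: \<epsilon>_def)
  then obtain N where N: "\<And>n. n \<ge> N \<Longrightarrow> b n < \<epsilon>"
    using order_tendstoD(2)[OF b, of \<epsilon>] by (auto simp: eventually_sequentially)
  have bound: "a (N + k) \<le> q ^ k * a N + \<delta> / 2" for k
  proof (induction k)
    case 0
    then show ?case using \<open>0 < \<delta>\<close> by simp
  next
    case (Suc k)
    have "a (N + Suc k) \<le> q * (a (N + k) + b (N + k))" using step[of "N + k"] by simp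
    also have "\<dots> \<le> q * ((q ^ k * a N + \<delta> / 2) + \<epsilon>)"
      using Suc N[of "N + k"] q by (intro mult_left_mono add_mono) auto
    also have "\<dots> = q ^ Suc k * a N + q * (\<delta> / 2 + \<epsilon>)" by (simp add: algebra_simps)
    also have "q * (\<delta> / 2 + \<epsilon>) \<le> \<delta> / 2"
    proof -
      have "\<delta> / 2 - q * (\<delta> / 2 + \<epsilon>) = \<delta> / 2 * (1 - q)\<^sup>2"
        by (simp add: \<epsilon>_def power2_eq_square field_simps)
      also have "\<dots> \<ge> 0" using \<open>0 < \<delta>\<close> by simp
      finally show ?thesis by simp
    qed
    finally show ?case by simp
  qed
  have "(\<lambda>k. q ^ k * a N) \<longlonglongrightarrow> 0 * a N"
    using q by (intro tendsto_mult LIMSEQ_power_zero tendsto_const) simp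
  then obtain k0 where k0: "\<And>k. k \<ge> k0 \<Longrightarrow> q ^ k * a N < \<delta> / 2"
    using order_tendstoD(2)[of _ "0 * a N" sequentially "\<delta> / 2"] \<open>0 < \<delta>\<close>
    by (auto simp: eventually_sequentially)
  show "\<exists>no. \<forall>n\<ge>no. norm (a n - 0) < \<delta>"
  proof (intro exI allI impI)
    fix n assume "N + k0 \<le> n"
    then have "N + (n - N) = n" "k0 \<le> n - N" by simp_all
    then have "a n < \<delta>" using bound[of "n - N"] k0[of "n - N"] by simp
    then show "norm (a n - 0) < \<delta>" using a by simp
  qed
qed

section \<open>The iteration\<close>

text \<open>In \<open>tau_step\<close> the conventions 1/0 = 0/0 = \<infinity> are realized by the
  value \<open>\<tau> (n - 1)\<close>, which is neutral in the outer minimum. Saddle points enter as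
  premises of single lemmas, because the energy is used relative to two of them: a given one and a
  cluster point.\<close>

locale pgrpda =
  fixes f :: "'a::euclidean_space \<Rightarrow> ereal" and g :: "'b::euclidean_space \<Rightarrow> ereal"
    and K :: "'a \<Rightarrow> 'b" and h :: "'a \<Rightarrow> real" and gh :: "'a \<Rightarrow> 'a" and Lbar :: real
    and \<psi> \<mu> \<mu>' \<beta> :: real
    and z x :: "nat \<Rightarrow> 'a" and w y :: "nat \<Rightarrow> 'b" and \<tau> :: "nat \<Rightarrow> real"
  assumes K_lin: "linear K"
    and f_prop: "proper_fun f" "convex_fun f" "lsc_fun f"
    and g_prop: "proper_fun g" "convex_fun g" "lsc_fun g"
    and h_conv: "convex_on UNIV h"
    and h_grad: "\<And>u. (h has_derivative (\<lambda>d. inner (gh u) d)) (at u)"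
    and h_lip: "\<And>u v. norm (gh u - gh v) \<le> Lbar * norm (u - v)"
    and psi: "1 < \<psi>"
    and mu: "0 < 3 * \<mu>'" "3 * \<mu>' < \<mu>"
            "\<mu> < \<psi> / 2 + \<psi> * (1 + \<psi> - \<psi>\<^sup>2) / (2 * (\<psi> + 1))"
    and beta: "\<beta> > 0" and tau0: "\<tau> 0 > 0"
    and z_step: "\<And>n. n \<ge> 1 \<Longrightarrow> z n = ((\<psi> - 1) / \<psi>) *\<^sub>R x (n - 1) + (1 / \<psi>) *\<^sub>R z (n - 1)"
    and x_step: "\<And>n. n \<ge> 1 \<Longrightarrow> x n = prox (\<tau> (n - 1)) f
                   (z n - \<tau> (n - 1) *\<^sub>R adjoint K (y (n - 1)) - \<tau> (n - 1) *\<^sub>R gh (x (n - 1)))"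
    and tau_step: "\<And>n. n \<ge> 1 \<Longrightarrow> \<tau> n = min (\<tau> (n - 1))
                   (min (if K (x n) = K (x (n - 1)) then \<tau> (n - 1)
                         else \<mu> * norm (x n - x (n - 1)) / (sqrt \<beta> * norm (K (x n) - K (x (n - 1)))))
                        (if gh (x n) = gh (x (n - 1)) then \<tau> (n - 1)
                         else \<mu>' * norm (x n - x (n - 1)) / norm (gh (x n) - gh (x (n - 1)))))"
    and w_step: "\<And>n. n \<ge> 1 \<Longrightarrow> w n = prox (1 / (\<beta> * \<tau> n)) g
                   ((1 / (\<beta> * \<tau> n)) *\<^sub>R y (n - 1) + K (x n))"
    and y_step: "\<And>n. n \<ge> 1 \<Longrightarrow> y n = y (n - 1) + (\<beta> * \<tau> n) *\<^sub>R (K (x n) - w n)"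
begin

section \<open>Parameter margins and step sizes\<close>

lemma mu_pos: "0 < \<mu>'" "0 < \<mu>"
  using mu by simp_all

lemma mu_less_1: "\<mu> < 1"
proof -
  have "0 < \<psi>" using psi by simp
  then show ?thesis using descent_coeff_1_less_2 descent_coeff_1 mu(3) by fastforce
qed

text \<open>This is the limiting weight of the squared primal increment in the descent. The upper
  bound on \<mu> gives \<open>descent_coeff \<psi> 1 > 2 * \<mu>\<close>, which leaves more than
  \<open>\<mu> - 2 * \<mu>'\<close>.\<close>

lemma descent_coeff_margin: "0 < descent_coeff \<psi> 1 - \<mu> - 2 * \<mu>'"
proof -
  have "0 < \<psi>" using psi by simp
  then have "2 * \<mu> < descent_coeff \<psi> 1" using descent_coeff_1 mu(3) by simp
  then show ?thesis using mu(1,2) by linarith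
qed

lemma step_size_decreasing: "\<tau> (Suc n) \<le> \<tau> n"
proof -
  have "\<tau> (Suc n) \<le> \<tau> (Suc n - 1)" by (subst tau_step) (simp, rule min.cobounded1)
  then show ?thesis by simp
qed

text \<open>Boundedness of \<open>K\<close> and the Lipschitz bound on \<open>gh\<close> keep both
  quotients in the step size rule above constants; induction carries the smallest of these and
  \<open>\<tau> 0\<close> along.\<close>

lemma step_size_lower_bound: "\<exists>c>0. \<forall>n. c \<le> \<tau> n"
proof -
  obtain B where B: "0 < B" "\<And>v. norm (K v) \<le> B * norm v"
    using linear_bounded_pos[OF K_lin] by blast
  \<comment> \<open>Strictly positive even if \<open>Lbar\<close> is 0, so that
    \<open>\<mu>' / L\<close> is a proper bound.\<close>
  define L where "L = \<bar>Lbar\<bar> + 1"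
  have L: "0 < L" "norm (gh u - gh v) \<le> L * norm (u - v)" for u v
  proof -
    show "0 < L" by (simp add: L_def)
    have "Lbar * norm (u - v) \<le> L * norm (u - v)" by (intro mult_right_mono) (auto simp: L_def)
    then show "norm (gh u - gh v) \<le> L * norm (u - v)" using h_lip[of u v] by linarith
  qed
  define c where "c = min (\<tau> 0) (min (\<mu> / (sqrt \<beta> * B)) (\<mu>' / L))"
  have "c > 0" using tau0 mu_pos beta B L by (simp add: c_def)
  moreover have "c \<le> \<tau> n" for n
  proof (induction n)
    case 0
    then show ?case by (simp add: c_def)
  next
    case (Suc n)
    have 1: "c \<le> \<mu> * norm (x (Suc n) - x n) / (sqrt \<beta> * norm (K (x (Suc n)) - K (x n)))"
      if "K (x (Suc n)) \<noteq> K (x n)"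
    proof -
      have p: "0 < sqrt \<beta> * norm (K (x (Suc n)) - K (x n))" using that beta by simp
      have "norm (K (x (Suc n)) - K (x n)) \<le> B * norm (x (Suc n) - x n)"
        using B(2)[of "x (Suc n) - x n"] by (simp add: linear_diff[OF K_lin])
      then have "\<mu> / (sqrt \<beta> * B) * (sqrt \<beta> * norm (K (x (Suc n)) - K (x n)))
          \<le> \<mu> / (sqrt \<beta> * B) * (sqrt \<beta> * (B * norm (x (Suc n) - x n)))"
        using mu_pos beta B by (intro mult_left_mono) auto
      also have "\<dots> = \<mu> * norm (x (Suc n) - x n)" using B(1) beta by simp
      finally have "\<mu> / (sqrt \<beta> * B) \<le> \<mu> * norm (x (Suc n) - x n) / (sqrt \<beta> * norm (K (x (Suc n)) - K (x n)))"
        using p by (simp add: pos_le_divide_eq)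
      then show ?thesis by (simp add: c_def)
    qed
    have 2: "c \<le> \<mu>' * norm (x (Suc n) - x n) / norm (gh (x (Suc n)) - gh (x n))"
      if "gh (x (Suc n)) \<noteq> gh (x n)"
    proof -
      have p: "0 < norm (gh (x (Suc n)) - gh (x n))" using that by simp
      have "\<mu>' / L * norm (gh (x (Suc n)) - gh (x n)) \<le> \<mu>' / L * (L * norm (x (Suc n) - x n))"
        using mu_pos L by (intro mult_left_mono) auto
      also have "\<dots> = \<mu>' * norm (x (Suc n) - x n)" using L(1) by simp
      finally have "\<mu>' / L \<le> \<mu>' * norm (x (Suc n) - x n) / norm (gh (x (Suc n)) - gh (x n))"
        using p by (simp add: pos_le_divide_eq)
      then show ?thesis by (simp add: c_def)
    qed
    \<comment> \<open>When a denominator vanishes the rule returns \<open>\<tau> n\<close>, which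
      the induction hypothesis covers.\<close>
    show ?case using tau_step[of "Suc n"] Suc 1 2 by auto
  qed
  ultimately show ?thesis by (intro exI[of _ c]) auto
qed

lemma step_size_pos: "0 < \<tau> n"
proof -
  obtain c where "0 < c" "c \<le> \<tau> n" using step_size_lower_bound by auto
  then show ?thesis by linarith
qed

text \<open>The quotient is multiplied out so that a vanishing denominator needs no separate
  treatment later. The bound uses the new step size, hence the ratio of consecutive steps in the
  descent.\<close>

lemma step_size_K: "\<tau> (Suc n) * (sqrt \<beta> * norm (K (x (Suc n)) - K (x n))) \<le> \<mu> * norm (x (Suc n) - x n)"
proof (cases "K (x (Suc n)) = K (x n)")
  case True
  then show ?thesis using mu_pos by simp
next
  case False
  then have "\<tau> (Suc n) \<le> \<mu> * norm (x (Suc n) - x n) / (sqrt \<beta> * norm (K (x (Suc n)) - K (x n)))"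
    using tau_step[of "Suc n"] by (simp add: min_le_iff_disj)
  then show ?thesis using False beta by (simp add: pos_le_divide_eq)
qed

lemma step_size_gh: "\<tau> (Suc n) * norm (gh (x (Suc n)) - gh (x n)) \<le> \<mu>' * norm (x (Suc n) - x n)"
proof (cases "gh (x (Suc n)) = gh (x n)")
  case True
  then show ?thesis using mu_pos by simp
next
  case False
  then have "\<tau> (Suc n) \<le> \<mu>' * norm (x (Suc n) - x n) / norm (gh (x (Suc n)) - gh (x n))"
    using tau_step[of "Suc n"] by (simp add: min_le_iff_disj)
  then show ?thesis using False by (simp add: pos_le_divide_eq)
qed

lemma step_size_convergent: "\<exists>T>0. \<tau> \<longlonglongrightarrow> T"
proof -
  obtain c where c: "c > 0" "\<And>n. c \<le> \<tau> n" using step_size_lower_bound by blast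
  have "decseq \<tau>" using step_size_decreasing by (rule decseq_SucI)
  then obtain T where T: "\<tau> \<longlonglongrightarrow> T" using c(2) decseq_convergent[of \<tau> c] by blast
  moreover have "c \<le> T" using T c(2) by (intro LIMSEQ_le_const) auto
  ultimately show ?thesis using c(1) by (intro exI[of _ T]) auto
qed

section \<open>Optimality conditions of one iteration and the energy inequality\<close>

lemma x_subgrad:
  "subgrad f (x (Suc n)) ((1 / \<tau> n) *\<^sub>R (z (Suc n) - x (Suc n)) - adjoint K (y n) - gh (x n))"
proof -
  let ?v = "z (Suc n) - \<tau> n *\<^sub>R adjoint K (y n) - \<tau> n *\<^sub>R gh (x n)"
  have "x (Suc n) = prox (\<tau> n) f ?v" using x_step[of "Suc n"] by simp
  then have "subgrad f (x (Suc n)) ((1 / \<tau> n) *\<^sub>R (?v - x (Suc n)))"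
    using prox_subgrad[OF f_prop step_size_pos, of n ?v] by metis
  moreover have "(1 / \<tau> n) *\<^sub>R (?v - x (Suc n))
     = (1 / \<tau> n) *\<^sub>R (z (Suc n) - x (Suc n)) - adjoint K (y n) - gh (x n)"
    using step_size_pos[of n] by (simp add: algebra_simps)
  ultimately show ?thesis by simp
qed

lemma w_eq: "w (Suc n) = K (x (Suc n)) - (1 / (\<beta> * \<tau> (Suc n))) *\<^sub>R (y (Suc n) - y n)"
proof -
  have "y (Suc n) - y n = (\<beta> * \<tau> (Suc n)) *\<^sub>R (K (x (Suc n)) - w (Suc n))"
    using y_step[of "Suc n"] by simp
  then show ?thesis using step_size_pos[of "Suc n"] beta by simp
qed

text \<open>Moreau's identity in disguise: the residual of the proximal step for \<open>g\<close>,
  scaled by \<open>\<beta> * \<tau> (Suc n)\<close>, is exactly the updated dual iterate.\<close>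

lemma w_subgrad: "subgrad g (w (Suc n)) (y (Suc n))"
proof -
  let ?s = "\<beta> * \<tau> (Suc n)"
  let ?v = "(1 / ?s) *\<^sub>R y n + K (x (Suc n))"
  have s: "0 < ?s" using beta step_size_pos by simp
  have "w (Suc n) = prox (1 / ?s) g ?v" using w_step[of "Suc n"] by simp
  then have "subgrad g (w (Suc n)) ((1 / (1 / ?s)) *\<^sub>R (?v - w (Suc n)))"
    using prox_subgrad[OF g_prop, of "1 / ?s" ?v] s by (metis zero_less_divide_1_iff)
  moreover have "(1 / (1 / ?s)) *\<^sub>R (?v - w (Suc n)) = y (Suc n)"
    using y_step[of "Suc n"] s beta step_size_pos[of "Suc n"] by (simp add: algebra_simps)
  ultimately show ?thesis by simp
qed

text \<open>Lets the optimality condition at \<open>x (Suc n)\<close> be expressed with the same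
  averaged point as the next one, which brings the factor \<psi> into the descent.\<close>

lemma z_diff: "z (Suc n) - x (Suc n) = \<psi> *\<^sub>R (z (Suc (Suc n)) - x (Suc n))"
proof -
  have "(\<psi> - 1) / \<psi> = 1 - 1 / \<psi>" using psi by (simp add: field_simps)
  then have "z (Suc (Suc n)) = (1 - 1 / \<psi>) *\<^sub>R x (Suc n) + (1 / \<psi>) *\<^sub>R z (Suc n)"
    using z_step[of "Suc (Suc n)"] by simp
  then have "z (Suc (Suc n)) - x (Suc n) = (1 / \<psi>) *\<^sub>R (z (Suc n) - x (Suc n))"
    by (simp add: algebra_simps)
  then show ?thesis using psi by simp
qed

text \<open>The inequalities \<open>e1\<close> to \<open>e6\<close> run in closed cycles:
  \<open>xs\<close>, \<open>x (n + 1)\<close>, \<open>x (n + 2)\<close> for \<open>f\<close>, the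
  points \<open>ys\<close>, \<open>y (n + 1)\<close> for the conjugate, and \<open>xs\<close>,
  \<open>x (n + 1)\<close> for \<open>h\<close>. All function values cancel in the sum, and the
  surviving coupling and gradient terms involve increments only.\<close>

lemma saddle_inner_ineq:
  assumes "saddle_point f h K g xs ys"
  shows "inner (z (n + 2) - x (n + 2)) (xs - x (n + 2))
      + \<tau> (n + 1) / \<tau> n * \<psi> * inner (z (n + 2) - x (n + 1)) (x (n + 2) - x (n + 1))
      - 1 / \<beta> * inner (y (n + 1) - y n) (ys - y (n + 1))
    \<le> - \<tau> (n + 1) * inner (y (n + 1) - y n) (K (x (n + 2)) - K (x (n + 1)))
      - \<tau> (n + 1) * inner (gh (x (n + 1)) - gh (x n)) (x (n + 2) - x (n + 1))"
proof -
  let ?X0 = "x n" and ?X1 = "x (n + 1)" and ?X2 = "x (n + 2)" and ?Z = "z (n + 2)"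
  let ?Y0 = "y n" and ?Y1 = "y (n + 1)" and ?t0 = "\<tau> n" and ?t1 = "\<tau> (n + 1)"
  have t: "0 < ?t0" "0 < ?t1" using step_size_pos by auto
  have sp: "\<bar>f xs\<bar> \<noteq> \<infinity>" "subgrad (conj_fun g) ys (K xs)"
    "\<And>u. f xs + ereal (h xs + inner (K xs) ys) \<le> f u + ereal (h u + inner (K u) ys)"
    using assms unfolding saddle_point_iff[OF f_prop(1) g_prop(1)] by auto
  have s1: "subgrad f ?X1 ((1 / ?t0) *\<^sub>R (z (n + 1) - ?X1) - adjoint K ?Y0 - gh ?X0)"
    using x_subgrad[of n] by simp
  have s2: "subgrad f ?X2 ((1 / ?t1) *\<^sub>R (?Z - ?X2) - adjoint K ?Y1 - gh ?X1)"
    using x_subgrad[of "n + 1"] by simp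
  have s3: "subgrad (conj_fun g) ?Y1 (w (n + 1))"
    using subgrad_conj_fun[OF w_subgrad[of n]] by simp
  obtain Fs F1 F2 where F: "f xs = ereal Fs" "f ?X1 = ereal F1" "f ?X2 = ereal F2"
    using sp(1) s1 s2 unfolding subgrad_def by (cases "f xs"; cases "f ?X1"; cases "f ?X2") auto
  obtain Gs G1 where G: "conj_fun g ys = ereal Gs" "conj_fun g ?Y1 = ereal G1"
    using sp(2) s3 unfolding subgrad_def by (cases "conj_fun g ys"; cases "conj_fun g ?Y1") auto
  have adj: "inner (adjoint K u) v = inner u (K v)" for u v
    using adjoint_works[OF K_lin, of v u] by (simp add: inner_commute)
  have lin: "inner (a *\<^sub>R p - adjoint K q - r) (v - v') = a * inner p (v - v') - inner q (K v - K v') - inner r (v - v')"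
    for a p q r v v'
    by (simp add: inner_diff_left[where z = "v - v'"] adj linear_diff[OF K_lin])
  have e1: "F2 + (1 / ?t1) * inner (?Z - ?X2) (xs - ?X2) - inner ?Y1 (K xs - K ?X2) - inner (gh ?X1) (xs - ?X2) \<le> Fs"
  proof -
    have "ereal F2 + ereal (inner ((1 / ?t1) *\<^sub>R (?Z - ?X2) - adjoint K ?Y1 - gh ?X1) (xs - ?X2)) \<le> ereal Fs"
      using s2 F unfolding subgrad_def by metis
    then show ?thesis by (simp add: lin)
  qed
  have e2: "F1 + (\<psi> / ?t0) * inner (?Z - ?X1) (?X2 - ?X1) - inner ?Y0 (K ?X2 - K ?X1) - inner (gh ?X0) (?X2 - ?X1) \<le> F2"
  proof -
    have "ereal F1 + ereal (inner ((1 / ?t0) *\<^sub>R (z (n + 1) - ?X1) - adjoint K ?Y0 - gh ?X0) (?X2 - ?X1)) \<le> ereal F2"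
      using s1 F unfolding subgrad_def by metis
    moreover have "z (n + 1) - ?X1 = \<psi> *\<^sub>R (?Z - ?X1)" using z_diff[of n] by simp
    ultimately show ?thesis by (simp add: lin)
  qed
  have e3: "G1 + inner (K ?X1) (ys - ?Y1) - (1 / (\<beta> * ?t1)) * inner (?Y1 - ?Y0) (ys - ?Y1) \<le> Gs"
  proof -
    have "ereal G1 + ereal (inner (w (n + 1)) (ys - ?Y1)) \<le> ereal Gs"
      using s3 G unfolding subgrad_def by metis
    moreover have "w (n + 1) = K ?X1 - (1 / (\<beta> * ?t1)) *\<^sub>R (?Y1 - ?Y0)" using w_eq[of n] by simp
    moreover have "inner (p - a *\<^sub>R q) v = inner p v - a * inner q v" for p q v :: 'b and a
      by (simp add: inner_diff_left)
    ultimately show ?thesis by simp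
  qed
  \<comment> \<open>Minimality of \<open>xs\<close> is tested at \<open>x (n + 1)\<close>, the point
    whose image under \<open>K\<close> entered the dual step in \<open>e3\<close>.\<close>
  have e4: "Fs + h xs + inner (K xs) ys \<le> F1 + h ?X1 + inner (K ?X1) ys"
    using sp(3)[of ?X1] F by simp
  have e5: "Gs + inner (K xs) (?Y1 - ys) \<le> G1"
  proof -
    have "ereal Gs + ereal (inner (K xs) (?Y1 - ys)) \<le> ereal G1"
      using sp(2) G unfolding subgrad_def by metis
    then show ?thesis by simp
  qed
  have e6: "h ?X1 + inner (gh ?X1) (xs - ?X1) \<le> h xs"
    by (rule convex_on_gradient_ineq[OF h_conv h_grad])
  have "(1 / ?t1) * inner (?Z - ?X2) (xs - ?X2) + (\<psi> / ?t0) * inner (?Z - ?X1) (?X2 - ?X1)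
      - (1 / (\<beta> * ?t1)) * inner (?Y1 - ?Y0) (ys - ?Y1)
      \<le> inner ?Y1 (K xs - K ?X2) + inner (gh ?X1) (xs - ?X2) + inner ?Y0 (K ?X2 - K ?X1)
        + inner (gh ?X0) (?X2 - ?X1) - inner (K ?X1) (ys - ?Y1) - inner (K xs) ys + inner (K ?X1) ys
        - inner (K xs) (?Y1 - ys) - inner (gh ?X1) (xs - ?X1)"
    using e1 e2 e3 e4 e5 e6 by linarith
  also have "\<dots> = - inner (?Y1 - ?Y0) (K ?X2 - K ?X1) - inner (gh ?X1 - gh ?X0) (?X2 - ?X1)"
    by (simp add: inner_diff_left inner_diff_right inner_commute)
  \<comment> \<open>Scaling by the newer step size normalizes the first term and leaves the step
    ratio in the second.\<close>
  finally have "?t1 * ((1 / ?t1) * inner (?Z - ?X2) (xs - ?X2) + (\<psi> / ?t0) * inner (?Z - ?X1) (?X2 - ?X1)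
      - (1 / (\<beta> * ?t1)) * inner (?Y1 - ?Y0) (ys - ?Y1))
      \<le> ?t1 * (- inner (?Y1 - ?Y0) (K ?X2 - K ?X1) - inner (gh ?X1 - gh ?X0) (?X2 - ?X1))"
    using t by (intro mult_left_mono) auto
  moreover have "?t1 * (1 / ?t1) = 1" "?t1 * (\<psi> / ?t0) = ?t1 / ?t0 * \<psi>" "?t1 * (1 / (\<beta> * ?t1)) = 1 / \<beta>"
    using t beta by auto
  then have "?t1 * ((1 / ?t1) * inner (?Z - ?X2) (xs - ?X2) + (\<psi> / ?t0) * inner (?Z - ?X1) (?X2 - ?X1)
      - (1 / (\<beta> * ?t1)) * inner (?Y1 - ?Y0) (ys - ?Y1))
     = inner (?Z - ?X2) (xs - ?X2) + ?t1 / ?t0 * \<psi> * inner (?Z - ?X1) (?X2 - ?X1)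
      - 1 / \<beta> * inner (?Y1 - ?Y0) (ys - ?Y1)"
    by (simp only: distrib_left right_diff_distrib mult.assoc[symmetric])
  ultimately show ?thesis by (simp only: right_diff_distrib mult_minus_left mult_minus_right)
qed

text \<open>The index of \<open>z\<close> is two ahead because \<open>z (n + 2)\<close> averages
  \<open>x (n + 1)\<close>, which is computed from \<open>y n\<close>. The last summand stores the
  part of the next gradient error that is charged to the current increment.\<close>

definition energy :: "'a \<Rightarrow> 'b \<Rightarrow> nat \<Rightarrow> real" where
  "energy xs ys n = \<psi> / (\<psi> - 1) * (norm (z (n + 2) - xs))\<^sup>2 + 1 / \<beta> * (norm (y n - ys))\<^sup>2
     + \<mu>' * (norm (x (n + 1) - x n))\<^sup>2"

text \<open>Cauchy-Schwarz, the step size rule and Young's inequality absorb both error terms of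
  \<open>saddle_inner_ineq\<close>. Of the loss \<open>2 * \<mu>'\<close>, one \<mu>' comes from the
  gradient error and one from the increment term of the new energy.\<close>

lemma energy_descent:
  assumes "saddle_point f h K g xs ys"
  shows "energy xs ys (n + 1)
     + (descent_coeff \<psi> (\<tau> (n + 1) / \<tau> n) - \<mu> * (\<tau> (n + 1) / \<tau> (n + 2)) - 2 * \<mu>') * (norm (x (n + 2) - x (n + 1)))\<^sup>2
     + (1 - \<mu> * (\<tau> (n + 1) / \<tau> (n + 2))) / \<beta> * (norm (y (n + 1) - y n))\<^sup>2 \<le> energy xs ys n"
proof -
  \<comment> \<open>The coupling error carries the factor \<open>\<tau> (n + 1)\<close>, whereas the
    increment of \<open>K x\<close> it contains is controlled by \<open>\<tau> (n + 2)\<close>; this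
    ratio makes up for the mismatch.\<close>
  define \<rho> where "\<rho> = \<tau> (n + 1) / \<tau> (n + 2)"
  define D where "D = norm (x (n + 2) - x (n + 1))"
  define D0 where "D0 = norm (x (n + 1) - x n)"
  define E where "E = norm (y (n + 1) - y n)"
  have t: "0 < \<tau> (n + 1)" "0 < \<tau> (n + 2)" using step_size_pos by auto
  have sb: "0 < sqrt \<beta>" using beta by simp
  have "- \<tau> (n + 1) * inner (y (n + 1) - y n) (K (x (n + 2)) - K (x (n + 1)))
      \<le> \<tau> (n + 1) * (E * norm (K (x (n + 2)) - K (x (n + 1))))"
  proof -
    have "- inner (y (n + 1) - y n) (K (x (n + 2)) - K (x (n + 1))) \<le> E * norm (K (x (n + 2)) - K (x (n + 1)))"
      unfolding E_def using Cauchy_Schwarz_ineq2[of "y (n + 1) - y n" "K (x (n + 2)) - K (x (n + 1))"] by linarith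
    from mult_left_mono[OF this, of "\<tau> (n + 1)"] show ?thesis using t by simp
  qed
  \<comment> \<open>Dividing \<open>E\<close> by \<open>sqrt \<beta>\<close> makes Young's
    inequality produce the dual increment with the energy's own weight
    \<open>1 / \<beta>\<close>.\<close>
  also have "\<dots> \<le> \<mu> * \<rho> * (D * (E / sqrt \<beta>))"
  proof -
    have "\<tau> (n + 2) * (sqrt \<beta> * norm (K (x (n + 2)) - K (x (n + 1)))) \<le> \<mu> * D"
      using step_size_K[of "n + 1"] by (simp add: D_def)
    then have "\<rho> * (E / sqrt \<beta>) * (\<tau> (n + 2) * (sqrt \<beta> * norm (K (x (n + 2)) - K (x (n + 1)))))
      \<le> \<rho> * (E / sqrt \<beta>) * (\<mu> * D)"
      using t sb by (intro mult_left_mono) (auto simp: \<rho>_def E_def)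
    moreover have "\<rho> * (E / sqrt \<beta>) * (\<tau> (n + 2) * (sqrt \<beta> * norm (K (x (n + 2)) - K (x (n + 1)))))
      = \<tau> (n + 1) * (E * norm (K (x (n + 2)) - K (x (n + 1))))"
      using t sb by (simp add: \<rho>_def)
    ultimately show ?thesis by (simp add: mult_ac)
  qed
  also have "\<dots> \<le> \<mu> * \<rho> * ((D\<^sup>2 + E\<^sup>2 / \<beta>) / 2)"
  proof (rule mult_left_mono)
    from mult_le_half_sum_squares[of D "E / sqrt \<beta>"] show "D * (E / sqrt \<beta>) \<le> (D\<^sup>2 + E\<^sup>2 / \<beta>) / 2"
      using beta by (simp only: power_divide real_sqrt_pow2 less_imp_le)
    show "0 \<le> \<mu> * \<rho>" using mu_pos t by (simp add: \<rho>_def)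
  qed
  finally have k: "- \<tau> (n + 1) * inner (y (n + 1) - y n) (K (x (n + 2)) - K (x (n + 1))) \<le> \<mu> * \<rho> * ((D\<^sup>2 + E\<^sup>2 / \<beta>) / 2)" .
  have "- \<tau> (n + 1) * inner (gh (x (n + 1)) - gh (x n)) (x (n + 2) - x (n + 1))
      \<le> \<tau> (n + 1) * (norm (gh (x (n + 1)) - gh (x n)) * D)"
  proof -
    have "- inner (gh (x (n + 1)) - gh (x n)) (x (n + 2) - x (n + 1)) \<le> norm (gh (x (n + 1)) - gh (x n)) * D"
      unfolding D_def using Cauchy_Schwarz_ineq2[of "gh (x (n + 1)) - gh (x n)" "x (n + 2) - x (n + 1)"] by linarith
    from mult_left_mono[OF this, of "\<tau> (n + 1)"] show ?thesis using t by simp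
  qed
  \<comment> \<open>Here the indices agree, so no step ratio appears; the price is the earlier
    increment \<open>D0\<close>.\<close>
  also have "\<dots> \<le> (\<mu>' * D0) * D"
    using mult_right_mono[OF step_size_gh[of n], of D] by (simp add: D_def D0_def mult.assoc)
  also have "\<dots> \<le> \<mu>' * ((D0\<^sup>2 + D\<^sup>2) / 2)"
  proof -
    have "\<mu>' * (D0 * D) \<le> \<mu>' * ((D0\<^sup>2 + D\<^sup>2) / 2)"
      using mu_pos mult_le_half_sum_squares by (intro mult_left_mono) auto
    then show ?thesis by (simp only: mult.assoc)
  qed
  finally have gr: "- \<tau> (n + 1) * inner (gh (x (n + 1)) - gh (x n)) (x (n + 2) - x (n + 1)) \<le> \<mu>' * ((D0\<^sup>2 + D\<^sup>2) / 2)" .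
  have Z: "z (n + 3) = ((\<psi> - 1) / \<psi>) *\<^sub>R x (n + 2) + (1 / \<psi>) *\<^sub>R z (n + 2)"
  proof -
    have "n + 3 - 1 = n + 2" by simp
    then show ?thesis using z_step[of "n + 3"] by (metis le_add2 one_le_numeral order_trans)
  qed
  have core: "inner (z (n + 2) - x (n + 2)) (xs - x (n + 2))
      + \<tau> (n + 1) / \<tau> n * \<psi> * inner (z (n + 2) - x (n + 1)) (x (n + 2) - x (n + 1))
      - 1 / \<beta> * inner (y (n + 1) - y n) (ys - y (n + 1))
      \<le> \<mu> * \<rho> * ((D\<^sup>2 + E\<^sup>2 / \<beta>) / 2) + \<mu>' * ((D0\<^sup>2 + D\<^sup>2) / 2)"
    using saddle_inner_ineq[OF assms, of n] k gr by linarith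
  have n3: "n + 1 + 2 = n + 3" "n + 1 + 1 = n + 2" by simp_all
  have combine: "(a' + b' + m' * d) + (c - r - 2 * m') * d + (1 - r) / \<beta> * e \<le> a'' + b'' + m' * d0"
    if "a' + b' + c * d + 1 / \<beta> * e \<le> a'' + b'' + 2 * (r * ((d + e / \<beta>) / 2) + m' * ((d0 + d) / 2))"
    for a' b' a'' b'' c r m' d e d0 :: real
    using that by (simp add: algebra_simps diff_divide_distrib add_divide_distrib)
  show ?thesis
    unfolding energy_def n3 \<rho>_def[symmetric] D_def[symmetric] D0_def[symmetric] E_def[symmetric]
    by (rule combine) (use golden_ratio_energy_step[OF psi Z core] in \<open>simp only: D_def E_def\<close>)
qed

section \<open>Convergence of the energy and vanishing increments\<close>

lemma step_size_ratio_tendsto: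
  "(\<lambda>n. \<tau> (n + 1) / \<tau> n) \<longlonglongrightarrow> 1" "(\<lambda>n. \<tau> (n + 1) / \<tau> (n + 2)) \<longlonglongrightarrow> 1"
proof -
  obtain T where T: "T > 0" "\<tau> \<longlonglongrightarrow> T" using step_size_convergent by blast
  note T1 = LIMSEQ_ignore_initial_segment[OF T(2), of 1]
  note T2 = LIMSEQ_ignore_initial_segment[OF T(2), of 2]
  show "(\<lambda>n. \<tau> (n + 1) / \<tau> n) \<longlonglongrightarrow> 1" using tendsto_divide[OF T1 T(2)] T(1) by simp
  show "(\<lambda>n. \<tau> (n + 1) / \<tau> (n + 2)) \<longlonglongrightarrow> 1" using tendsto_divide[OF T1 T2] T(1) by simp
qed

lemma eventual_energy_descent:
  assumes sp: "saddle_point f h K g xs ys"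
  shows "\<exists>\<epsilon>>0. \<forall>\<^sub>F n in sequentially.
    energy xs ys (n + 1) + \<epsilon> * ((norm (x (n + 2) - x (n + 1)))\<^sup>2 + (norm (y (n + 1) - y n))\<^sup>2) \<le> energy xs ys n"
proof -
  let ?c = "\<lambda>n. descent_coeff \<psi> (\<tau> (n + 1) / \<tau> n) - \<mu> * (\<tau> (n + 1) / \<tau> (n + 2)) - 2 * \<mu>'"
  let ?d = "\<lambda>n. (1 - \<mu> * (\<tau> (n + 1) / \<tau> (n + 2))) / \<beta>"
  have "1 + 1 / \<psi> \<noteq> 0" using psi by (simp add: add_pos_pos less_imp_neq[symmetric])
  then have "(\<lambda>n. descent_coeff \<psi> (\<tau> (n + 1) / \<tau> n)) \<longlonglongrightarrow> descent_coeff \<psi> 1"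
    unfolding descent_coeff_def by (intro tendsto_intros step_size_ratio_tendsto)
  then have c: "?c \<longlonglongrightarrow> descent_coeff \<psi> 1 - \<mu> * 1 - 2 * \<mu>'"
    by (intro tendsto_intros step_size_ratio_tendsto)
  have d: "?d \<longlonglongrightarrow> (1 - \<mu> * 1) / \<beta>"
    using beta by (intro tendsto_intros step_size_ratio_tendsto) simp
  \<comment> \<open>Half of the smaller of the two limiting coefficients, hence eventually below
    both coefficients.\<close>
  define \<epsilon> where "\<epsilon> = min (descent_coeff \<psi> 1 - \<mu> - 2 * \<mu>') ((1 - \<mu>) / \<beta>) / 2"
  have pos: "0 < descent_coeff \<psi> 1 - \<mu> - 2 * \<mu>'" "0 < (1 - \<mu>) / \<beta>"
    using descent_coeff_margin mu_less_1 beta by simp_all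
  have half_min: "0 < min a b / 2 \<and> min a b / 2 < a \<and> min a b / 2 < b" if "0 < a" "0 < b" for a b :: real
    using that by (auto simp: min_def)
  from pos have \<epsilon>: "0 < \<epsilon>" "\<epsilon> < descent_coeff \<psi> 1 - \<mu> * 1 - 2 * \<mu>'" "\<epsilon> < (1 - \<mu> * 1) / \<beta>"
    using half_min[of "descent_coeff \<psi> 1 - \<mu> - 2 * \<mu>'" "(1 - \<mu>) / \<beta>"]
    unfolding \<epsilon>_def mult_1_right by blast+
  have "\<forall>\<^sub>F n in sequentially. \<epsilon> < ?c n" "\<forall>\<^sub>F n in sequentially. \<epsilon> < ?d n"
    using order_tendstoD(1)[OF c \<epsilon>(2)] order_tendstoD(1)[OF d \<epsilon>(3)] by blast+
  then have "\<forall>\<^sub>F n in sequentially.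
    energy xs ys (n + 1) + \<epsilon> * ((norm (x (n + 2) - x (n + 1)))\<^sup>2 + (norm (y (n + 1) - y n))\<^sup>2) \<le> energy xs ys n"
  proof eventually_elim
    case (elim n)
    have "\<epsilon> * (norm (x (n + 2) - x (n + 1)))\<^sup>2 \<le> ?c n * (norm (x (n + 2) - x (n + 1)))\<^sup>2"
      "\<epsilon> * (norm (y (n + 1) - y n))\<^sup>2 \<le> ?d n * (norm (y (n + 1) - y n))\<^sup>2"
      using elim by (intro mult_right_mono; simp)+
    then show ?case
      using energy_descent[OF sp, of n] unfolding distrib_left by linarith
  qed
  then show ?thesis using \<epsilon>(1) by blast
qed

lemma energy_bounds:
  "0 \<le> energy xs ys n" "(norm (z (n + 2) - xs))\<^sup>2 \<le> energy xs ys n"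
  "(norm (y n - ys))\<^sup>2 \<le> \<beta> * energy xs ys n"
proof -
  have a: "1 \<le> \<psi> / (\<psi> - 1)" using psi by (simp add: field_simps)
  have z: "1 * (norm (z (n + 2) - xs))\<^sup>2 \<le> \<psi> / (\<psi> - 1) * (norm (z (n + 2) - xs))\<^sup>2"
    using a by (intro mult_right_mono) auto
  have y: "0 \<le> 1 / \<beta> * (norm (y n - ys))\<^sup>2" using beta by simp
  have x: "0 \<le> \<mu>' * (norm (x (n + 1) - x n))\<^sup>2" using mu_pos by simp
  have z0: "0 \<le> (norm (z (n + 2) - xs))\<^sup>2" by simp
  show "(norm (z (n + 2) - xs))\<^sup>2 \<le> energy xs ys n" using z y x unfolding energy_def by linarith
  with z0 show "0 \<le> energy xs ys n" by linarith
  have "1 / \<beta> * (norm (y n - ys))\<^sup>2 \<le> energy xs ys n" using z z0 x unfolding energy_def by linarith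
  then have "\<beta> * (1 / \<beta> * (norm (y n - ys))\<^sup>2) \<le> \<beta> * energy xs ys n"
    using beta by (intro mult_left_mono) auto
  then show "(norm (y n - ys))\<^sup>2 \<le> \<beta> * energy xs ys n" using beta by simp
qed

lemma energy_convergent:
  assumes sp: "saddle_point f h K g xs ys"
  shows "convergent (energy xs ys)"
proof -
  obtain \<epsilon> N where \<epsilon>: "\<epsilon> > 0" and N: "\<And>n. n \<ge> N \<Longrightarrow>
    energy xs ys (n + 1) + \<epsilon> * ((norm (x (n + 2) - x (n + 1)))\<^sup>2 + (norm (y (n + 1) - y n))\<^sup>2) \<le> energy xs ys n"
    using eventual_energy_descent[OF sp] unfolding eventually_sequentially by blast
  have "energy xs ys (Suc n + N) \<le> energy xs ys (n + N)" for n
  proof -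
    have "0 \<le> \<epsilon> * ((norm (x (n + N + 2) - x (n + N + 1)))\<^sup>2 + (norm (y (n + N + 1) - y (n + N)))\<^sup>2)"
      using \<epsilon> by simp
    then show ?thesis using N[of "n + N"] by simp
  qed
  then have "decseq (\<lambda>n. energy xs ys (n + N))" by (intro decseq_SucI) simp
  then obtain c where "(\<lambda>n. energy xs ys (n + N)) \<longlonglongrightarrow> c"
    by (rule decseq_convergent[where B = 0]) (simp add: energy_bounds)
  then have "energy xs ys \<longlonglongrightarrow> c" by (rule LIMSEQ_offset)
  then show ?thesis by (rule convergentI)
qed

text \<open>Because the energy converges, its consecutive differences tend to 0, and eventually they
  dominate a fixed multiple of the squared increments.\<close>

lemma increments_tendsto_0:
  assumes sp: "saddle_point f h K g xs ys"
  shows "(\<lambda>n. x (n + 1) - x n) \<longlonglongrightarrow> 0" "(\<lambda>n. y (n + 1) - y n) \<longlonglongrightarrow> 0"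
proof -
  let ?s = "\<lambda>n. (norm (x (n + 2) - x (n + 1)))\<^sup>2 + (norm (y (n + 1) - y n))\<^sup>2"
  obtain \<epsilon> where \<epsilon>: "\<epsilon> > 0" and ev: "\<forall>\<^sub>F n in sequentially.
    energy xs ys (n + 1) + \<epsilon> * ?s n \<le> energy xs ys n"
    using eventual_energy_descent[OF sp] by blast
  obtain c where c: "energy xs ys \<longlonglongrightarrow> c" using energy_convergent[OF sp] convergent_def by blast
  have "(\<lambda>n. (energy xs ys n - energy xs ys (n + 1)) / \<epsilon>) \<longlonglongrightarrow> (c - c) / \<epsilon>"
    using \<epsilon> by (intro tendsto_intros c LIMSEQ_ignore_initial_segment) auto
  then have lim: "(\<lambda>n. (energy xs ys n - energy xs ys (n + 1)) / \<epsilon>) \<longlonglongrightarrow> 0" by simp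
  have le: "\<forall>\<^sub>F n in sequentially. ?s n \<le> (energy xs ys n - energy xs ys (n + 1)) / \<epsilon>"
    using ev
  proof eventually_elim
    case (elim n)
    then have "?s n * \<epsilon> \<le> energy xs ys n - energy xs ys (n + 1)" by (simp add: mult.commute)
    then show ?case using \<epsilon> by (simp add: pos_le_divide_eq)
  qed
  have "(\<lambda>n. (norm (x (n + 2) - x (n + 1)))\<^sup>2) \<longlonglongrightarrow> 0"
    by (rule tendsto_sandwich[OF _ _ tendsto_const lim])
      (use le in \<open>auto elim!: eventually_mono intro: order_trans[rotated]\<close>)
  then have "(\<lambda>n. sqrt ((norm (x (n + 2) - x (n + 1)))\<^sup>2)) \<longlonglongrightarrow> sqrt 0" by (rule tendsto_real_sqrt)
  then have "(\<lambda>n. x (n + 2) - x (n + 1)) \<longlonglongrightarrow> 0" by (simp add: tendsto_norm_zero_iff)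
  then have "(\<lambda>n. x (n + 1 + 1) - x (n + 1)) \<longlonglongrightarrow> 0" by simp
  then show "(\<lambda>n. x (n + 1) - x n) \<longlonglongrightarrow> 0" by (rule LIMSEQ_offset)
  have "(\<lambda>n. (norm (y (n + 1) - y n))\<^sup>2) \<longlonglongrightarrow> 0"
    by (rule tendsto_sandwich[OF _ _ tendsto_const lim])
      (use le in \<open>auto elim!: eventually_mono intro: order_trans[rotated]\<close>)
  then have "(\<lambda>n. sqrt ((norm (y (n + 1) - y n))\<^sup>2)) \<longlonglongrightarrow> sqrt 0" by (rule tendsto_real_sqrt)
  then show "(\<lambda>n. y (n + 1) - y n) \<longlonglongrightarrow> 0" by (simp add: tendsto_norm_zero_iff)
qed

text \<open>By \<open>z_diff\<close> the gap shrinks by the factor \<open>1 / \<psi> < 1\<close> at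
  each step, up to a perturbation by the increment of \<open>x\<close>, which vanishes.\<close>

lemma z_minus_x_tendsto_0:
  assumes sp: "saddle_point f h K g xs ys"
  shows "(\<lambda>n. z (n + 2) - x (n + 1)) \<longlonglongrightarrow> 0"
proof -
  have "(\<lambda>n. norm (z (n + 2) - x (n + 1))) \<longlonglongrightarrow> 0"
  proof (rule perturbed_contraction_tendsto_0[where q = "1 / \<psi>" and b = "\<lambda>n. norm (x (n + 2) - x (n + 1))"])
    fix n
    have "z (n + 2) - x (n + 2) = \<psi> *\<^sub>R (z (n + 3) - x (n + 2))"
      using z_diff[of "n + 1"] by (simp add: eval_nat_numeral)
    then have "norm (z (n + 2) - x (n + 2)) = \<psi> * norm (z (n + 3) - x (n + 2))"
      using psi by simp
    moreover have "norm (z (n + 2) - x (n + 2)) \<le> norm (z (n + 2) - x (n + 1)) + norm (x (n + 2) - x (n + 1))"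
      using norm_triangle_ineq4[of "z (n + 2) - x (n + 1)" "x (n + 2) - x (n + 1)"] by simp
    ultimately have "norm (z (n + 3) - x (n + 2)) \<le> 1 / \<psi> * (norm (z (n + 2) - x (n + 1)) + norm (x (n + 2) - x (n + 1)))"
      using psi by (simp add: field_simps)
    then show "norm (z (Suc n + 2) - x (Suc n + 1)) \<le> 1 / \<psi> * (norm (z (n + 2) - x (n + 1)) + norm (x (n + 2) - x (n + 1)))"
      by (simp add: eval_nat_numeral)
  next
    have "(\<lambda>n. x (n + 1 + 1) - x (n + 1)) \<longlonglongrightarrow> 0"
      using LIMSEQ_ignore_initial_segment[OF increments_tendsto_0(1)[OF sp], of 1] by simp
    then show "(\<lambda>n. norm (x (n + 2) - x (n + 1))) \<longlonglongrightarrow> 0"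
      using tendsto_norm_zero by fastforce
  qed (use psi in auto)
  then show ?thesis by (rule tendsto_norm_zero_cancel)
qed

section \<open>Cluster points and convergence of the whole sequence\<close>

lemma saddle_point_of_subgrad:
  assumes "subgrad f xs (- adjoint K ys - gh xs)" and "subgrad g (K xs) ys"
  shows "saddle_point f h K g xs ys"
  unfolding saddle_point_iff[OF f_prop(1) g_prop(1)]
proof (intro conjI allI)
  show fin: "\<bar>f xs\<bar> \<noteq> \<infinity>" using assms(1) unfolding subgrad_def by (rule conjunct1)
  show "subgrad (conj_fun g) ys (K xs)" by (rule subgrad_conj_fun[OF assms(2)])
  fix u
  have "f xs + ereal (inner (- adjoint K ys - gh xs) (u - xs)) \<le> f u"
    using assms(1) unfolding subgrad_def by blast
  moreover have "inner (- adjoint K ys - gh xs) (u - xs) = inner (K xs) ys - inner (K u) ys - inner (gh xs) (u - xs)"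
    using adjoint_works[OF K_lin, of u ys] adjoint_works[OF K_lin, of xs ys]
    by (simp add: inner_diff_left inner_diff_right inner_commute)
  moreover have "h xs + inner (gh xs) (u - xs) \<le> h u"
    by (rule convex_on_gradient_ineq[OF h_conv h_grad])
  ultimately show "f xs + ereal (h xs + inner (K xs) ys) \<le> f u + ereal (h u + inner (K u) ys)"
    using fin by (cases "f xs"; cases "f u") auto
qed

text \<open>Vanishing increments give all shifted iterates the same limits along \<open>r\<close>,
  so the optimality conditions pass to the limit by the closed graph. Convergence is assumed for
  \<open>z\<close> because the energy controls \<open>z\<close>, and \<open>x\<close> follows
  it.\<close>

lemma cluster_point_is_saddle_point:
  assumes sp: "saddle_point f h K g xs ys" and r: "strict_mono r"
    and zr: "(\<lambda>k. z (r k + 2)) \<longlonglongrightarrow> xh" and yr: "(\<lambda>k. y (r k)) \<longlonglongrightarrow> yh"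
  shows "saddle_point f h K g xh yh"
proof (rule saddle_point_of_subgrad)
  have rlim: "filterlim r sequentially sequentially" by (rule filterlim_subseq[OF r])
  note dx = filterlim_compose[OF LIMSEQ_ignore_initial_segment[OF increments_tendsto_0(1)[OF sp], of 1] rlim]
  note dy = filterlim_compose[OF increments_tendsto_0(2)[OF sp] rlim]
  note zx = filterlim_compose[OF z_minus_x_tendsto_0[OF sp] rlim]
  obtain T where T: "T > 0" "\<tau> \<longlonglongrightarrow> T" using step_size_convergent by blast
  have \<tau>r: "(\<lambda>k. \<tau> (r k + 1)) \<longlonglongrightarrow> T"
    using filterlim_compose[OF LIMSEQ_ignore_initial_segment[OF T(2), of 1] rlim] .
  have x1: "(\<lambda>k. x (r k + 1)) \<longlonglongrightarrow> xh" using tendsto_diff[OF zr zx] by simp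
  have x2: "(\<lambda>k. x (r k + 2)) \<longlonglongrightarrow> xh" using tendsto_add[OF x1 dx] by simp
  have y1: "(\<lambda>k. y (r k + 1)) \<longlonglongrightarrow> yh" using tendsto_add[OF yr dy] by simp
  have linK: "bounded_linear K" "bounded_linear (adjoint K)"
    using K_lin adjoint_linear[OF K_lin] by (auto simp: linear_conv_bounded_linear)
  have ghr: "(\<lambda>k. gh (x (r k + 1))) \<longlonglongrightarrow> gh xh"
  proof -
    have "(\<lambda>k. Lbar * norm (x (r k + 1) - xh)) \<longlonglongrightarrow> Lbar * norm (xh - xh)"
      by (intro tendsto_intros x1)
    then have "(\<lambda>k. Lbar * norm (x (r k + 1) - xh)) \<longlonglongrightarrow> 0" by simp
    then have "(\<lambda>k. gh (x (r k + 1)) - gh xh) \<longlonglongrightarrow> 0"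
      by (rule Lim_null_comparison[rotated]) (intro always_eventually allI h_lip)
    then show ?thesis by (rule LIM_zero_cancel)
  qed
  show "subgrad f xh (- adjoint K yh - gh xh)"
  proof (rule subgrad_limit[OF f_prop(1,3) _ x2])
    fix k
    show "subgrad f (x (r k + 2)) ((1 / \<tau> (r k + 1)) *\<^sub>R (z (r k + 2) - x (r k + 2)) - adjoint K (y (r k + 1)) - gh (x (r k + 1)))"
      using x_subgrad[of "r k + 1"] by simp
  next
    \<comment> \<open>The proximal residual vanishes: \<open>z\<close> and \<open>x\<close> share
      the limit \<open>xh\<close>, while the positive limit \<open>T\<close> keeps the reciprocal
      step sizes convergent.\<close>
    have "(\<lambda>k. (1 / \<tau> (r k + 1)) *\<^sub>R (z (r k + 2) - x (r k + 2)) - adjoint K (y (r k + 1)) - gh (x (r k + 1)))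
      \<longlonglongrightarrow> (1 / T) *\<^sub>R (xh - xh) - adjoint K yh - gh xh"
      using T(1) by (intro tendsto_intros \<tau>r zr x2 ghr bounded_linear.tendsto[OF linK(2)] y1) simp
    then show "(\<lambda>k. (1 / \<tau> (r k + 1)) *\<^sub>R (z (r k + 2) - x (r k + 2)) - adjoint K (y (r k + 1)) - gh (x (r k + 1)))
      \<longlonglongrightarrow> - adjoint K yh - gh xh" by simp
  qed
  show "subgrad g (K xh) yh"
  proof (rule subgrad_limit[OF g_prop(1,3) _ _ y1])
    show "subgrad g (w (r k + 1)) (y (r k + 1))" for k using w_subgrad[of "r k"] by simp
    have "(\<lambda>k. K (x (r k + 1)) - (1 / (\<beta> * \<tau> (r k + 1))) *\<^sub>R (y (r k + 1) - y (r k)))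
       \<longlonglongrightarrow> K xh - (1 / (\<beta> * T)) *\<^sub>R 0"
      using T(1) beta by (intro tendsto_intros \<tau>r dy bounded_linear.tendsto[OF linK(1)] x1) simp
    then show "(\<lambda>k. w (r k + 1)) \<longlonglongrightarrow> K xh" using w_eq by simp
  qed
qed

text \<open>A Fejer-type argument with two energies: the one at the given saddle point yields
  boundedness and a cluster point, the one recentred at that cluster point converges and has limit 0
  along the subsequence.\<close>

theorem converges_to_saddle_point:
  assumes "\<exists>xs ys. saddle_point f h K g xs ys"
  shows "\<exists>xs ys. saddle_point f h K g xs ys \<and> x \<longlonglongrightarrow> xs \<and> y \<longlonglongrightarrow> ys"
proof -
  obtain xs ys where sp: "saddle_point f h K g xs ys" using assms by blast
  have "Bseq (energy xs ys)" by (rule convergent_imp_Bseq[OF energy_convergent[OF sp]])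
  then obtain M where "\<And>n. norm (energy xs ys n) \<le> M" by (auto simp: Bseq_def)
  then have M: "energy xs ys n \<le> M" for n by (metis abs_le_D1 real_norm_def)
  have "norm (z (n + 2) - xs) \<le> sqrt M" for n
    using energy_bounds(2)[of n xs ys] M[of n] by (intro real_le_rsqrt) linarith
  then have bz: "bounded (range (\<lambda>n. z (n + 2)))"
    by (intro bounded_subset[OF bounded_cball[of xs "sqrt M"]]) (auto simp: dist_norm norm_minus_commute)
  have "norm (y n - ys) \<le> sqrt (\<beta> * M)" for n
    using energy_bounds(3)[of n ys xs] mult_left_mono[OF M[of n], of \<beta>] beta
    by (intro real_le_rsqrt) linarith
  then have "bounded (range y)"
    by (intro bounded_subset[OF bounded_cball[of ys "sqrt (\<beta> * M)"]]) (auto simp: dist_norm norm_minus_commute)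
  \<comment> \<open>Compactness is applied to the pairs, so that one subsequence serves both
    components.\<close>
  with bz have "bounded (range (\<lambda>n. (z (n + 2), y n)))"
    by (rule bounded_subset[OF bounded_Times]) auto
  then obtain l r where r: "strict_mono r" and l: "((\<lambda>n. (z (n + 2), y n)) \<circ> r) \<longlonglongrightarrow> l"
    using bounded_imp_convergent_subsequence by blast
  define xh yh where "xh = fst l" and "yh = snd l"
  have zr: "(\<lambda>k. z (r k + 2)) \<longlonglongrightarrow> xh" using tendsto_fst[OF l] by (simp add: xh_def o_def)
  have yr: "(\<lambda>k. y (r k)) \<longlonglongrightarrow> yh" using tendsto_snd[OF l] by (simp add: yh_def o_def)
  have sph: "saddle_point f h K g xh yh" by (rule cluster_point_is_saddle_point[OF sp r zr yr])
  obtain c where c: "energy xh yh \<longlonglongrightarrow> c" using energy_convergent[OF sph] convergent_def by blast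
  have rlim: "filterlim r sequentially sequentially" by (rule filterlim_subseq[OF r])
  have "(\<lambda>k. energy xh yh (r k)) \<longlonglongrightarrow>
      \<psi> / (\<psi> - 1) * (norm (xh - xh))\<^sup>2 + 1 / \<beta> * (norm (yh - yh))\<^sup>2 + \<mu>' * (norm (0::'a))\<^sup>2"
    unfolding energy_def
    by (intro tendsto_intros zr yr filterlim_compose[OF increments_tendsto_0(1)[OF sp] rlim])
  then have "(\<lambda>k. energy xh yh (r k)) \<longlonglongrightarrow> 0" by simp
  \<comment> \<open>The full recentred energy has a limit, so its value along the subsequence
    decides it.\<close>
  then have "c = 0" using filterlim_compose[OF c rlim] LIMSEQ_unique by blast
  with c have E0: "energy xh yh \<longlonglongrightarrow> 0" by simp
  then have E0s: "(\<lambda>n. sqrt (energy xh yh n)) \<longlonglongrightarrow> 0"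
    using tendsto_real_sqrt by fastforce
  have "(\<lambda>n. z (n + 2) - xh) \<longlonglongrightarrow> 0"
    using E0s by (rule Lim_null_comparison[rotated])
      (intro always_eventually allI real_le_rsqrt energy_bounds)
  then have zlim: "(\<lambda>n. z (n + 2)) \<longlonglongrightarrow> xh" by (rule LIM_zero_cancel)
  have "(\<lambda>n. x (n + 1)) \<longlonglongrightarrow> xh"
    using tendsto_diff[OF zlim z_minus_x_tendsto_0[OF sp]] by simp
  then have xlim: "x \<longlonglongrightarrow> xh" by (rule LIMSEQ_offset)
  have "(\<lambda>n. sqrt (\<beta> * energy xh yh n)) \<longlonglongrightarrow> sqrt (\<beta> * 0)"
    by (intro tendsto_intros E0)
  then have "(\<lambda>n. sqrt (\<beta> * energy xh yh n)) \<longlonglongrightarrow> 0" by simp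
  then have "(\<lambda>n. y n - yh) \<longlonglongrightarrow> 0"
    by (rule Lim_null_comparison[rotated])
      (intro always_eventually allI real_le_rsqrt energy_bounds)
  then have "y \<longlonglongrightarrow> yh" by (rule LIM_zero_cancel)
  with sph xlim show ?thesis by blast
qed

end

theorem theorem3p2:
  fixes f :: "'a::euclidean_space \<Rightarrow> ereal" and g :: "'b::euclidean_space \<Rightarrow> ereal"
    and K :: "'a \<Rightarrow> 'b" and h :: "'a \<Rightarrow> real" and gh :: "'a \<Rightarrow> 'a" and Lbar :: real
    and \<psi> \<mu> \<mu>' \<beta> :: real
    and z x :: "nat \<Rightarrow> 'a" and w y :: "nat \<Rightarrow> 'b" and \<tau> :: "nat \<Rightarrow> real"
  assumes K_lin: "linear K"
    and f_prop: "proper_fun f" "convex_fun f" "lsc_fun f"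
    and g_prop: "proper_fun g" "convex_fun g" "lsc_fun g"
    and h_conv: "convex_on UNIV h"
    and h_grad: "\<And>u. (h has_derivative (\<lambda>d. inner (gh u) d)) (at u)"
    and h_lip: "\<And>u v. norm (gh u - gh v) \<le> Lbar * norm (u - v)"
    and sol_ex: "\<exists>xs ys. saddle_point f h K g xs ys"
    and qual: "0 \<in> rel_interior {K u - v | u v. u \<in> edom f \<and> v \<in> edom g}"
    and psi: "1 < \<psi>" "\<psi> < 1 + sqrt 3"
    and mu: "0 < 3 * \<mu>'" "3 * \<mu>' < \<mu>"
            "\<mu> < \<psi> / 2 + \<psi> * (1 + \<psi> - \<psi>\<^sup>2) / (2 * (\<psi> + 1))"
    and beta: "\<beta> > 0" and tau0: "\<tau> 0 > 0"
    and z0: "z 0 = x 0"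
    and z_step: "\<And>n. n \<ge> 1 \<Longrightarrow> z n = ((\<psi> - 1) / \<psi>) *\<^sub>R x (n - 1) + (1 / \<psi>) *\<^sub>R z (n - 1)"
    and x_step: "\<And>n. n \<ge> 1 \<Longrightarrow> x n = prox (\<tau> (n - 1)) f
                   (z n - \<tau> (n - 1) *\<^sub>R adjoint K (y (n - 1)) - \<tau> (n - 1) *\<^sub>R gh (x (n - 1)))"
    and tau_step: "\<And>n. n \<ge> 1 \<Longrightarrow> \<tau> n = min (\<tau> (n - 1))
                   (min (if K (x n) = K (x (n - 1)) then \<tau> (n - 1)
                         else \<mu> * norm (x n - x (n - 1)) / (sqrt \<beta> * norm (K (x n) - K (x (n - 1)))))
                        (if gh (x n) = gh (x (n - 1)) then \<tau> (n - 1)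
                         else \<mu>' * norm (x n - x (n - 1)) / norm (gh (x n) - gh (x (n - 1)))))"
    and w_step: "\<And>n. n \<ge> 1 \<Longrightarrow> w n = prox (1 / (\<beta> * \<tau> n)) g
                   ((1 / (\<beta> * \<tau> n)) *\<^sub>R y (n - 1) + K (x n))"
    and y_step: "\<And>n. n \<ge> 1 \<Longrightarrow> y n = y (n - 1) + (\<beta> * \<tau> n) *\<^sub>R (K (x n) - w n)"
  shows "\<exists>xs ys. saddle_point f h K g xs ys \<and> x \<longlonglongrightarrow> xs \<and> y \<longlonglongrightarrow> ys"
proof -
  interpret pgrpda f g K h gh Lbar \<psi> \<mu> \<mu>' \<beta> z x w y \<tau>
    by (rule pgrpda.intro) (fact assms)+
  show ?thesis by (rule converges_to_saddle_point[OF sol_ex])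
qed

end
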